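(* Consider a link failure model on a graph $G=(V,E)$ with link probabilities $p_{ij}$, $\{i,j\}\in E$. Let $P$ be the symmetric matrix with $P_{ij}=p_{ij}$ for $\{i,j\}\in E$, $P_{ii}=0$ for $i=1,\ldots,N$, and $P_{ij}=0$ for $\{i,j\}\notin E$, and let $-\log(1-P)$ denote the matrix with entries $-\log(1-P_{ij})$. Then the probability $p_{\max}$ of the most likely maximal disconnected collection and the rate $I$ for this model satisfy $$p_{\max}=e^{-\mathrm{mincut}(V,E,-\log(1-P))},\qquad I=\mathrm{mincut}(V,E,-\log(1-P)).$$
   Context: Let $V=\{1,\ldots,N\}$ with $N\ge2$, $E\subseteq\binom V2$. Matrix process. $\{W_k\}_{k\ge1}$ are i.i.d. random $N\times N$ symmetric doubly stochastic matrices for which there is $\delta>0$ such that, for every realization $W$, all positive entries of $W$ are $\ge\delta$ and all diagonal entries satisfy $W_{ii}\ge\delta$. The induced graph of $W$ is $G(W)=(V,\{\{i,j\}:i\ne j,\,W_{ij}>0\})$, and $G_t=G(W_t)$. Link failure model on $(V,E)$: at each time $t$ each link $\{i,j\}\in E$ is present in $G_t$ with probability $p_{ij}\in[0,1]$, independently of all other links, and links outside $E$ never occur; the set of realizable graphs is $\mathcal G=\{(V,E'):E'\subseteq E\}$. Disconnected collections. For $\mathcal H\subseteq\mathcal G$, $\Gamma(\mathcal H)=(V,\bigcup_{G\in\mathcal H}E(G))$ and $p_{\mathcal H}=\sum_{H\in\mathcal H}\mathbb P(G_t=H)$. A nonempty $\mathcal H\subseteq\mathcal G$ is a maximal disconnected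 collection if $\Gamma(\mathcal H)$ is disconnected and $\Gamma(\mathcal H\cup\{G\})$ is connected for every $G\in\mathcal G\setminus\mathcal H$; $\Pi^\star(\mathcal G)$ is the set of these, and $p_{\max}=\max_{\mathcal H\in\Pi^\star(\mathcal G)}p_{\mathcal H}$. Rate. $I\in[0,+\infty]$ is the exponential rate of consensus: $\lim_{k\to\infty}\frac1k\log\mathbb P(\|W_k\cdots W_1-J\|\ge\epsilon)=-I$ for every $\epsilon\in(0,1]$, where $J=\frac1N\mathbf 1\mathbf 1^\top$ and $\|\cdot\|$ is the spectral norm; here it equals $|\log p_{\max}|$. Conventions: $\log 0=-\infty$, $e^{-\infty}=0$. Min-cut. For nonnegative (possibly $+\infty$) edge costs collected in $C=[c_{ij}]$ (with $c_{ii}=0$ and $c_{ij}=0$ for $\{i,j\}\notin E$), $\mathrm{mincut}(V,E,C)$ is the minimum of $\sum_{\{i,j\}\in F}c_{ij}$ over all $F\subseteq E$ such that $(V,E\setminus F)$ is disconnected. *)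

theory Defs
  imports "HOL-Probability.Probability"
begin

section \<open>Extended logarithm and exponential\<close>

definition ereal_ln :: "real \<Rightarrow> ereal" where
  "ereal_ln x = (if x \<le> 0 then -\<infinity> else ereal (ln x))"

definition ereal_exp :: "ereal \<Rightarrow> ereal" where
  "ereal_exp x = (case x of ereal r \<Rightarrow> ereal (exp r) | PInfty \<Rightarrow> \<infinity> | MInfty \<Rightarrow> 0)"

section \<open>Graphs on a fixed vertex set\<close>

text \<open>
  The vertex set V with N elements is the universe of a finite type \<open>'n\<close>, so that
  N is \<open>CARD('n)\<close>. All graphs occurring here share this vertex set, so a graph is
  represented by its set of edges, which are two-element sets of vertices.
\<close>

type_synonym 'n graph = "'n set set"

definition all_links :: "'n graph" where
  "all_links = {e. card e = 2}"

definition connected_graph :: "'n graph \<Rightarrow> bool" where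
  "connected_graph E \<longleftrightarrow> (\<forall>u v. (u, v) \<in> {(i, j). {i, j} \<in> E}\<^sup>*)"

section \<open>The matrix process and its rate of consensus\<close>

definition doubly_stochastic :: "real^'n^'n \<Rightarrow> bool" where
  "doubly_stochastic A \<longleftrightarrow>
     (\<forall>i j. A $ i $ j \<ge> 0) \<and> (\<forall>i. (\<Sum>j\<in>UNIV. A $ i $ j) = 1) \<and> (\<forall>j. (\<Sum>i\<in>UNIV. A $ i $ j) = 1)"

definition induced_graph :: "real^'n^'n \<Rightarrow> 'n graph" where
  "induced_graph A = {{i, j} |i j. i \<noteq> j \<and> A $ i $ j > 0}"

text \<open>Time starts at 1; the value of the family \<open>W\<close> at time 0 plays no role.\<close>

definition matrix_process :: "'a measure \<Rightarrow> (nat \<Rightarrow> 'a \<Rightarrow> real^'n^'n) \<Rightarrow> bool" where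
  "matrix_process M W \<longleftrightarrow>
     prob_space M \<and>
     prob_space.indep_vars M (\<lambda>_. borel) W {1..} \<and>
     (\<forall>t\<ge>1. distr M borel (W t) = distr M borel (W 1)) \<and>
     (\<forall>t\<ge>1. \<forall>\<omega>\<in>space M. transpose (W t \<omega>) = W t \<omega> \<and> doubly_stochastic (W t \<omega>)) \<and>
     (\<exists>\<delta>>0. \<forall>t\<ge>1. \<forall>\<omega>\<in>space M.
        (\<forall>i j. W t \<omega> $ i $ j > 0 \<longrightarrow> W t \<omega> $ i $ j \<ge> \<delta>) \<and> (\<forall>i. W t \<omega> $ i $ i \<ge> \<delta>))"

text \<open>\<open>backward_product W k \<omega>\<close> is the product of \<open>W k\<close>, ..., \<open>W 1\<close>, in this order.\<close>

primrec backward_product :: "(nat \<Rightarrow> 'a \<Rightarrow> real^'n^'n) \<Rightarrow> nat \<Rightarrow> 'a \<Rightarrow> real^'n^'n" where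
  "backward_product W 0 \<omega> = mat 1"
| "backward_product W (Suc k) \<omega> = W (Suc k) \<omega> ** backward_product W k \<omega>"

definition averaging_matrix :: "real^'n^'n" where
  "averaging_matrix = (\<chi> i j. 1 / real CARD('n))"

definition spectral_norm :: "real^'n^'n \<Rightarrow> real" where
  "spectral_norm A = onorm ((*v) A)"

definition has_consensus_rate ::
    "'a measure \<Rightarrow> (nat \<Rightarrow> 'a \<Rightarrow> real^'n^'n) \<Rightarrow> ereal \<Rightarrow> bool" where
  "has_consensus_rate M W I \<longleftrightarrow> 0 \<le> I \<and>
     (\<forall>\<epsilon>::real. 0 < \<epsilon> \<and> \<epsilon> \<le> 1 \<longrightarrow>
        (\<lambda>k. ereal (1 / real k) * ereal_ln (measure M
               {\<omega> \<in> space M. spectral_norm (backward_product W k \<omega> - averaging_matrix) \<ge> \<epsilon>}))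
        \<longlonglongrightarrow> - I)"

section \<open>The link failure model and disconnected collections\<close>

definition realizable_graphs :: "'n graph \<Rightarrow> 'n graph set" where
  "realizable_graphs E = {E'. E' \<subseteq> E}"

definition link_failure_model ::
    "'a measure \<Rightarrow> 'n graph \<Rightarrow> ('n set \<Rightarrow> real) \<Rightarrow> ('a \<Rightarrow> 'n graph) \<Rightarrow> bool" where
  "link_failure_model M E p G \<longleftrightarrow>
     (\<forall>\<omega>\<in>space M. G \<omega> \<in> realizable_graphs E) \<and>
     (\<forall>e\<in>E. measure M {\<omega> \<in> space M. e \<in> G \<omega>} = p e) \<and>
     prob_space.indep_events M (\<lambda>e. {\<omega> \<in> space M. e \<in> G \<omega>}) E"

definition max_disconnected_collections :: "'n graph set \<Rightarrow> 'n graph set set" where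
  "max_disconnected_collections \<G> =
     {\<H>. \<H> \<noteq> {} \<and> \<H> \<subseteq> \<G> \<and> \<not> connected_graph (\<Union>\<H>) \<and>
          (\<forall>G \<in> \<G> - \<H>. connected_graph (\<Union>(\<H> \<union> {G})))}"

definition collection_prob :: "'a measure \<Rightarrow> ('a \<Rightarrow> 'n graph) \<Rightarrow> 'n graph set \<Rightarrow> real" where
  "collection_prob M G \<H> = (\<Sum>H\<in>\<H>. measure M {\<omega> \<in> space M. G \<omega> = H})"

definition p_max :: "'a measure \<Rightarrow> ('a \<Rightarrow> 'n graph) \<Rightarrow> 'n graph set \<Rightarrow> real" where
  "p_max M G \<G> = Max (collection_prob M G ` max_disconnected_collections \<G>)"

section \<open>Minimum cut\<close>

text \<open>
  The entry of a symmetric matrix at an unordered pair of indices. Symmetry makes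
  the choice of the order irrelevant.
\<close>

definition entry_at :: "'c^'n^'n \<Rightarrow> 'n set \<Rightarrow> 'c" where
  "entry_at C e = (THE c. \<exists>i j. e = {i, j} \<and> c = C $ i $ j)"

lemma entry_at_symmetric:
  assumes "transpose C = C"
  shows "entry_at C {i, j} = C $ i $ j"
proof -
  have sym: "C $ a $ b = C $ b $ a" for a b
    by (metis assms transpose_def vec_lambda_beta)
  show ?thesis
    unfolding entry_at_def
    by (rule the_equality) (auto simp: doubleton_eq_iff sym)
qed

definition mincut :: "'n graph \<Rightarrow> ereal^'n^'n \<Rightarrow> ereal" where
  "mincut E C = Min {\<Sum>e\<in>F. entry_at C e |F. F \<subseteq> E \<and> \<not> connected_graph (E - F)}"

definition link_prob_matrix :: "'n graph \<Rightarrow> ('n set \<Rightarrow> real) \<Rightarrow> real^'n^'n" where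
  "link_prob_matrix E p = (\<chi> i j. if {i, j} \<in> E then p {i, j} else 0)"

definition neg_log_one_minus :: "real^'n^'n \<Rightarrow> ereal^'n^'n" where
  "neg_log_one_minus P = (\<chi> i j. - ereal_ln (1 - P $ i $ j))"

text \<open>
  As long as there are at least two vertices, \<open>p_max\<close> and \<open>mincut\<close> are maxima and
  minima of finite nonempty sets.
\<close>

lemma not_connected_graph_empty:
  assumes "CARD('n::finite) \<ge> 2"
  shows "\<not> connected_graph ({} :: 'n graph)"
proof
  assume c: "connected_graph ({} :: 'n graph)"
  have "\<not> CARD('n) \<le> 1"
    using assms by simp
  then obtain u v :: 'n where "u \<noteq> v"
    using card_le_Suc0_iff_eq[of "UNIV :: 'n set"] by auto
  with c show False
    unfolding connected_graph_def by auto
qed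

lemma mincut_set_finite_nonempty:
  fixes E :: "'n::finite graph"
  assumes "CARD('n) \<ge> 2"
  shows "finite {\<Sum>e\<in>F. entry_at C e |F. F \<subseteq> E \<and> \<not> connected_graph (E - F)}"
    and "{\<Sum>e\<in>F. entry_at C e |F. F \<subseteq> E \<and> \<not> connected_graph (E - F)} \<noteq> {}"
proof -
  have "{\<Sum>e\<in>F. entry_at C e |F. F \<subseteq> E \<and> \<not> connected_graph (E - F)} =
      (\<lambda>F. \<Sum>e\<in>F. entry_at C e) ` {F. F \<subseteq> E \<and> \<not> connected_graph (E - F)}"
    by blast
  moreover have "E \<in> {F. F \<subseteq> E \<and> \<not> connected_graph (E - F)}"
    using not_connected_graph_empty[OF assms] by simp
  ultimately show "finite {\<Sum>e\<in>F. entry_at C e |F. F \<subseteq> E \<and> \<not> connected_graph (E - F)}"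
    and "{\<Sum>e\<in>F. entry_at C e |F. F \<subseteq> E \<and> \<not> connected_graph (E - F)} \<noteq> {}"
    by auto
qed

lemma max_disconnected_collections_finite_nonempty:
  fixes E :: "'n::finite graph"
  assumes "CARD('n) \<ge> 2"
  shows "finite (max_disconnected_collections (realizable_graphs E))"
    and "max_disconnected_collections (realizable_graphs E) \<noteq> {}"
proof -
  show "finite (max_disconnected_collections (realizable_graphs E))"
    by simp
  let ?P = "\<lambda>\<H>. \<H> \<subseteq> realizable_graphs E \<and> \<not> connected_graph (\<Union>\<H>)"
  have "?P {{}}"
    using not_connected_graph_empty[OF assms] by (auto simp: realizable_graphs_def)
  moreover have "finite {\<H>. ?P \<H>}"
    by simp
  ultimately obtain \<H> where H: "?P \<H>" and sub: "{{}} \<subseteq> \<H>"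
    and maximal: "\<forall>\<K>\<in>{\<H>. ?P \<H>}. \<H> \<subseteq> \<K> \<longrightarrow> \<H> = \<K>"
    using finite_has_maximal2[of "{\<H>. ?P \<H>}" "{{}}"] by (metis (no_types, lifting) mem_Collect_eq)
  have conn: "connected_graph (\<Union>(\<H> \<union> {G}))" if G: "G \<in> realizable_graphs E - \<H>" for G
  proof (rule ccontr)
    assume "\<not> connected_graph (\<Union>(\<H> \<union> {G}))"
    with H G have "?P (\<H> \<union> {G})"
      by simp
    with maximal have "\<H> = \<H> \<union> {G}"
      by (metis (no_types, lifting) Un_upper1 mem_Collect_eq)
    with G show False
      by (metis DiffD2 UnI2 singletonI)
  qed
  have "\<H> \<in> max_disconnected_collections (realizable_graphs E)"
    unfolding max_disconnected_collections_def using H sub conn by blast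
  then show "max_disconnected_collections (realizable_graphs E) \<noteq> {}"
    by (metis empty_iff)
qed

end

theory Submission
  imports Defs
begin

text \<open>
  Put \<open>q = max\<^sub>F \<Prod>\<^bsub>e\<in>F\<^esub> (1 - p\<^sub>e)\<close> over the disconnecting sets \<open>F\<close> of links,
  so that \<open>- log q\<close> is the minimum cut. If no link ever crosses an optimal cut, which has
  probability \<open>q\<^sup>k\<close>, then a mean-zero vector that is constant on both sides is fixed, and the
  product stays at distance at least 1 from \<open>J\<close>. For the converse, follow a mean-zero
  vector \<open>x\<close>: its entries have a gap of at least \<open>|x| / N\<^sup>2\<close> along some cut. A matrix without
  link across this cut keeps the gap and does not increase the norm, and one with such a link shrinks
  the squared norm by a fixed factor. Being at distance at least \<open>\<epsilon>\<close> from \<open>J\<close> therefore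
  allows at most \<open>m = m(\<epsilon>)\<close> crossings. Polynomially many choices of crossing times and
  boundedly many of cuts remain, each of probability at most \<open>q\<^bsup>k-m\<^esup>\<close>.
\<close>

section \<open>Cuts and the contraction of mean-zero vectors\<close>

text \<open>Both orders of the indices occur because \<open>doubly_stochastic\<close> does not
  include symmetry.\<close>

definition respects_cut :: "real^'n^'n \<Rightarrow> 'n set \<Rightarrow> bool" where
  "respects_cut A S \<longleftrightarrow> (\<forall>i\<in>S. \<forall>j\<in>-S. A $ i $ j = 0 \<and> A $ j $ i = 0)"

definition proper_cuts :: "'n set set" where
  "proper_cuts = {S. S \<noteq> {} \<and> S \<noteq> UNIV}"

text \<open>The cut is oriented, with the larger entries on the side of \<open>S\<close>. The
  threshold loses a factor \<open>N\<close> twice: the pigeonhole argument yields a gap of one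
  \<open>N\<close>-th of the range of the entries, and for a mean-zero vector this range is at least
  \<open>norm x / N\<close>.\<close>

definition wide_cut :: "'n set \<Rightarrow> real^'n \<Rightarrow> bool" where
  "wide_cut S x \<longleftrightarrow> S \<in> proper_cuts \<and>
     (\<forall>i\<in>S. \<forall>j\<in>-S. norm x / (real CARD('n))\<^sup>2 \<le> x $ i - x $ j)"

definition uniformly_positive :: "real \<Rightarrow> real^'n^'n \<Rightarrow> bool" where
  "uniformly_positive \<delta> A \<longleftrightarrow> (\<forall>i j. A $ i $ j > 0 \<longrightarrow> A $ i $ j \<ge> \<delta>) \<and> (\<forall>i. A $ i $ i \<ge> \<delta>)"

text \<open>The power \<open>N ^ 4\<close> is the square of the denominator in
  \<open>wide_cut\<close>, and \<delta>/2 is the factor in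
  \<open>norm_decrement_link\<close>.\<close>

definition contraction_factor :: "real \<Rightarrow> nat \<Rightarrow> real" where
  "contraction_factor \<delta> N = 1 - \<delta> / (2 * real N ^ 4)"

text \<open>
  Measured in units of one \<open>N\<close>-th of the range, the \<open>N\<close> entries of the vector occupy at
  most \<open>N\<close> of the \<open>N + 1\<close> levels \<open>0, \<dots>, N\<close>; the entries are cut at a free level.
\<close>

lemma wide_cut_exists:
  fixes x :: "real^'n"
  assumes N: "CARD('n) \<ge> 2" and mean: "(\<Sum>i\<in>UNIV. x $ i) = 0"
  shows "\<exists>S. wide_cut S x"
proof (cases "x = 0")
  case True
  \<comment> \<open>For \<open>x = 0\<close> the threshold and all differences are 0, so every
    proper cut is wide. A singleton is proper because \<open>N\<close> is at least 2.\<close>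
  have "{undefined} \<noteq> (UNIV :: 'n set)"
  proof
    assume "{undefined} = (UNIV :: 'n set)"
    then have "CARD('n) = card {undefined :: 'n}" by metis
    with N show False by simp
  qed
  then have "wide_cut {undefined} x"
    using True by (auto simp: wide_cut_def proper_cuts_def)
  then show ?thesis ..
next
  case False
  define n where "n = real CARD('n)"
  have n: "n \<ge> 2" using N by (simp add: n_def)
  define a where "a = Min (range (($) x))"
  define b where "b = Max (range (($) x))"
  have a: "a \<le> x $ i" and b: "x $ i \<le> b" for i
    by (auto simp: a_def b_def)
  have "a \<in> range (($) x)" "b \<in> range (($) x)"
    unfolding a_def b_def by (auto intro!: Min_in Max_in)
  then obtain ia ib where ia: "x $ ia = a" and ib: "x $ ib = b"
    by (metis imageE)
  define D where "D = b - a"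
  have "n * a \<le> 0"
    using sum_mono[of UNIV "\<lambda>_. a" "($) x"] a mean by (simp add: n_def)
  then have a0: "a \<le> 0" using n by (simp add: mult_le_0_iff)
  have "0 \<le> n * b"
    using sum_mono[of UNIV "($) x" "\<lambda>_. b"] b mean by (simp add: n_def)
  then have b0: "b \<ge> 0" using n by (simp add: zero_le_mult_iff)
  \<comment> \<open>Mean zero puts 0 between the smallest and the largest entry, so the range
    \<open>D\<close> bounds every absolute value.\<close>
  have "\<bar>x $ i\<bar> \<le> D" for i
    using a[of i] b[of i] a0 b0 by (auto simp: D_def abs_if)
  then have "(\<Sum>i\<in>UNIV. \<bar>x $ i\<bar>) \<le> (\<Sum>i\<in>(UNIV :: 'n set). D)"
    by (intro sum_mono) auto
  then have normD: "norm x \<le> n * D"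
    using norm_le_l1_cart[of x] by (simp add: n_def)
  have D: "D > 0"
    using normD False n by (smt (verit) zero_less_norm_iff zero_less_mult_iff)
  define f where "f i = nat \<lceil>(x $ i - a) * n / D\<rceil>" for i
  have "card (range f) \<le> CARD('n)"
    by (rule card_image_le) simp
  then have "\<not> {0..CARD('n)} \<subseteq> range f"
    using card_mono[of "range f" "{0..CARD('n)}"] by auto
  then obtain l where l: "l \<le> CARD('n)" "l \<notin> range f"
    by (meson atLeastAtMost_iff subsetI)
  have fa: "f ia = 0" by (simp add: f_def ia)
  have fb: "f ib = CARD('n)"
    using D by (simp add: f_def ib D_def n_def)
  define S where "S = {i. l < f i}"
  have "l \<noteq> 0" "l \<noteq> CARD('n)" using fa fb l(2) by (metis rangeI)+
  then have "ib \<in> S" "ia \<notin> S" using l fa fb by (auto simp: S_def)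
  then have proper: "S \<in> proper_cuts" by (auto simp: proper_cuts_def)
  have gap: "norm x / n\<^sup>2 \<le> x $ i - x $ j" if "i \<in> S" "j \<in> -S" for i j
  proof -
    \<comment> \<open>The free level \<open>l\<close> lies strictly between \<open>f j\<close> and
      \<open>f i\<close>. These rounded-up values thus differ by at least 2, and the values before
      rounding by at least 1.\<close>
    have "f j \<noteq> l" using l(2) by auto
    then have ji: "l < f i" "f j < l" using that by (auto simp: S_def)
    from ji(1) have "real l < (x $ i - a) * n / D"
      unfolding f_def by linarith
    moreover from ji(2) have "(x $ j - a) * n / D \<le> real l - 1"
      unfolding f_def by linarith
    ultimately have "(x $ i - a) * n / D - (x $ j - a) * n / D \<ge> 1" by linarith
    then have "((x $ i - x $ j) * n) / D \<ge> 1"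
      by (simp add: diff_divide_distrib[symmetric] algebra_simps)
    then have "x $ i - x $ j \<ge> D / n"
      using D n by (simp add: field_simps)
    moreover have "norm x / n\<^sup>2 \<le> D / n"
      using normD n by (simp add: field_simps power2_eq_square)
    ultimately show ?thesis by linarith
  qed
  then show ?thesis using proper by (auto simp: wide_cut_def n_def)
qed

text \<open>The gap \<open>g\<close> survives since both sides are replaced by convex combinations of themselves.\<close>

lemma gap_respects_cut:
  fixes A :: "real^'n^'n"
  assumes A: "doubly_stochastic A" and resp: "respects_cut A S"
    and gap: "\<forall>i\<in>S. \<forall>j\<in>-S. g \<le> x $ i - x $ j"
    and u: "u \<in> S" and v: "v \<in> -S"
  shows "g \<le> (A *v x) $ u - (A *v x) $ v"
proof -
  have pos: "\<And>i j. A $ i $ j \<ge> 0" and row: "\<And>i. (\<Sum>j\<in>UNIV. A $ i $ j) = 1"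
    using A by (auto simp: doubly_stochastic_def)
  \<comment> \<open>Rows \<open>u\<close> and \<open>v\<close> are probability distributions, and
    \<open>g\<close> is averaged over their product. Pairs outside \<open>S\<close> times its
    complement have weight 0, so the gap may be inserted in every term.\<close>
  have "g = (\<Sum>i\<in>UNIV. \<Sum>j\<in>UNIV. A $ u $ i * A $ v $ j * g)"
    by (simp add: sum_distrib_left[symmetric] sum_distrib_right[symmetric] row)
  also have "\<dots> \<le> (\<Sum>i\<in>UNIV. \<Sum>j\<in>UNIV. A $ u $ i * A $ v $ j * (x $ i - x $ j))"
  proof (intro sum_mono)
    fix i j
    show "A $ u $ i * A $ v $ j * g \<le> A $ u $ i * A $ v $ j * (x $ i - x $ j)"
    proof (cases "i \<in> S \<and> j \<in> -S")
      case True
      then show ?thesis using gap pos by (intro mult_left_mono) auto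
    next
      case False
      then have "A $ u $ i = 0 \<or> A $ v $ j = 0"
        using resp u v by (auto simp: respects_cut_def)
      then show ?thesis by auto
    qed
  qed
  also have "\<dots> = (\<Sum>i\<in>UNIV. \<Sum>j\<in>UNIV. A $ u $ i * x $ i * A $ v $ j)
      - (\<Sum>i\<in>UNIV. \<Sum>j\<in>UNIV. A $ u $ i * (A $ v $ j * x $ j))"
    by (simp add: sum_subtractf[symmetric] algebra_simps)
  also have "\<dots> = (A *v x) $ u - (A *v x) $ v"
    by (simp add: matrix_vector_mult_def sum_distrib_left[symmetric] sum_distrib_right[symmetric] row)
  finally show ?thesis .
qed

section \<open>Decrease of the Euclidean norm under a doubly stochastic matrix\<close>

lemma norm_sq_cart: "(norm (x :: real^'n))\<^sup>2 = (\<Sum>i\<in>UNIV. (x $ i)\<^sup>2)"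
  by (simp add: norm_vec_def L2_set_def sum_nonneg)

text \<open>Under the weights of row \<open>i\<close> the entries of \<open>x\<close> have mean
  \<open>(A *v x) $ i\<close>, so each inner sum is a variance: second moment minus squared mean.
  Since the columns sum to 1, the second moments add up to the squared norm of
  \<open>x\<close>.\<close>

lemma norm_decrement:
  fixes A :: "real^'n^'n"
  assumes A: "doubly_stochastic A"
  shows "(norm x)\<^sup>2 - (norm (A *v x))\<^sup>2
    = (\<Sum>i\<in>UNIV. \<Sum>j\<in>UNIV. A $ i $ j * (x $ j - (A *v x) $ i)\<^sup>2)"
proof -
  have row: "\<And>i. (\<Sum>j\<in>UNIV. A $ i $ j) = 1" and col: "\<And>j. (\<Sum>i\<in>UNIV. A $ i $ j) = 1"
    using A by (auto simp: doubly_stochastic_def)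
  define y where "y = A *v x"
  have y: "(\<Sum>j\<in>UNIV. A $ i $ j * x $ j) = y $ i" for i
    by (simp add: y_def matrix_vector_mult_def)
  have "(\<Sum>j\<in>UNIV. A $ i $ j * (x $ j - y $ i)\<^sup>2)
      = (\<Sum>j\<in>UNIV. A $ i $ j * (x $ j)\<^sup>2) - (y $ i)\<^sup>2" for i
  proof -
    have "(\<Sum>j\<in>UNIV. A $ i $ j * (x $ j - y $ i)\<^sup>2)
      = (\<Sum>j\<in>UNIV. A $ i $ j * (x $ j)\<^sup>2) - 2 * y $ i * (\<Sum>j\<in>UNIV. A $ i $ j * x $ j)
        + (y $ i)\<^sup>2 * (\<Sum>j\<in>UNIV. A $ i $ j)"
      by (simp add: sum_distrib_left sum_subtractf[symmetric] sum.distrib[symmetric]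
          power2_eq_square algebra_simps)
    then show ?thesis by (simp add: row y power2_eq_square)
  qed
  then have "(\<Sum>i\<in>UNIV. \<Sum>j\<in>UNIV. A $ i $ j * (x $ j - y $ i)\<^sup>2)
      = (\<Sum>i\<in>UNIV. \<Sum>j\<in>UNIV. A $ i $ j * (x $ j)\<^sup>2) - (norm y)\<^sup>2"
    by (simp add: sum_subtractf norm_sq_cart)
  also have "(\<Sum>i\<in>UNIV. \<Sum>j\<in>UNIV. A $ i $ j * (x $ j)\<^sup>2) = (norm x)\<^sup>2"
    by (subst sum.swap) (simp add: sum_distrib_right[symmetric] col norm_sq_cart)
  finally show ?thesis by (simp add: y_def)
qed

lemma norm_nonincreasing:
  fixes A :: "real^'n^'n"
  assumes A: "doubly_stochastic A"
  shows "norm (A *v x) \<le> norm x"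
proof -
  have "0 \<le> (norm x)\<^sup>2 - (norm (A *v x))\<^sup>2"
    unfolding norm_decrement[OF A] using A by (intro sum_nonneg) (auto simp: doubly_stochastic_def)
  then show ?thesis by (simp add: power2_le_iff_abs_le)
qed

text \<open>Only the terms of row \<open>u\<close> in columns \<open>u\<close> and \<open>v\<close>
  are kept from the sum of variances. Both weights are at least \<delta>, the first by the bound on
  the diagonal. Two values cannot both be close to the same mean \<open>c\<close> if they are far
  from each other.\<close>

lemma norm_decrement_link:
  fixes A :: "real^'n^'n"
  assumes A: "doubly_stochastic A" and \<delta>: "0 < \<delta>" "uniformly_positive \<delta> A"
    and uv: "u \<noteq> v" "A $ u $ v \<noteq> 0"
  shows "\<delta> / 2 * (x $ u - x $ v)\<^sup>2 \<le> (norm x)\<^sup>2 - (norm (A *v x))\<^sup>2"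
proof -
  have pos: "\<And>i j. A $ i $ j \<ge> 0"
    using A by (auto simp: doubly_stochastic_def)
  then have "A $ u $ v > 0" using uv by (metis less_eq_real_def)
  then have d: "A $ u $ v \<ge> \<delta>" "A $ u $ u \<ge> \<delta>" using \<delta> by (auto simp: uniformly_positive_def)
  define c where "c = (A *v x) $ u"
  have "(x $ u - x $ v)\<^sup>2 / 2 \<le> (x $ u - c)\<^sup>2 + (x $ v - c)\<^sup>2"
  proof -
    \<comment> \<open>The square that completes the parallelogram identity; it is then dropped as
      nonnegative.\<close>
    define s where "s = ((x $ u - c) + (x $ v - c))\<^sup>2"
    have "s \<ge> 0" by (simp add: s_def)
    moreover have "(x $ u - x $ v)\<^sup>2 + s = 2 * ((x $ u - c)\<^sup>2 + (x $ v - c)\<^sup>2)"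
      by (simp add: s_def power2_eq_square algebra_simps)
    ultimately show ?thesis by simp
  qed
  then have "\<delta> / 2 * (x $ u - x $ v)\<^sup>2 \<le> \<delta> * (x $ u - c)\<^sup>2 + \<delta> * (x $ v - c)\<^sup>2"
    using \<delta>(1) by (auto dest: mult_left_mono[where c = \<delta>] simp: distrib_left)
  also have "\<dots> \<le> A $ u $ u * (x $ u - c)\<^sup>2 + A $ u $ v * (x $ v - c)\<^sup>2"
    using d by (intro add_mono mult_right_mono) auto
  also have "\<dots> = (\<Sum>j\<in>{u, v}. A $ u $ j * (x $ j - c)\<^sup>2)"
    using uv by simp
  also have "\<dots> \<le> (\<Sum>j\<in>UNIV. A $ u $ j * (x $ j - c)\<^sup>2)"
    using pos by (intro sum_mono2) auto
  also have "\<dots> \<le> (\<Sum>i\<in>UNIV. \<Sum>j\<in>UNIV. A $ i $ j * (x $ j - (A *v x) $ i)\<^sup>2)"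
    unfolding c_def using pos by (intro member_le_sum) (auto intro: sum_nonneg)
  finally show ?thesis by (simp add: norm_decrement[OF A])
qed

text \<open>The gap is preserved while the norm, and with it the required threshold, can only
  fall.\<close>

lemma wide_cut_respected:
  fixes A :: "real^'n^'n"
  assumes A: "doubly_stochastic A" and S: "wide_cut S x" "respects_cut A S"
  shows "wide_cut S (A *v x)"
proof -
  have "norm (A *v x) / (real CARD('n))\<^sup>2 \<le> norm x / (real CARD('n))\<^sup>2"
    using norm_nonincreasing[OF A] by (intro divide_right_mono) auto
  then show ?thesis
    using S gap_respects_cut[OF A S(2), of "norm x / (real CARD('n))\<^sup>2" x]
    unfolding wide_cut_def by (meson order_trans)
qed

lemma wide_cut_crossed:
  fixes A :: "real^'n^'n"
  assumes A: "doubly_stochastic A" and \<delta>: "0 < \<delta>" "uniformly_positive \<delta> A"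
    and S: "wide_cut S x" "\<not> respects_cut A S"
  shows "(norm (A *v x))\<^sup>2 \<le> contraction_factor \<delta> CARD('n) * (norm x)\<^sup>2"
proof -
  obtain i j where ij: "i \<in> S" "j \<in> -S" "A $ i $ j \<noteq> 0 \<or> A $ j $ i \<noteq> 0"
    using S(2) by (auto simp: respects_cut_def)
  have "norm x / (real CARD('n))\<^sup>2 \<le> x $ i - x $ j"
    using S(1) ij by (auto simp: wide_cut_def)
  then have "(norm x / (real CARD('n))\<^sup>2)\<^sup>2 \<le> (x $ i - x $ j)\<^sup>2"
    by (intro power_mono) auto
  then have "\<delta> / 2 * (norm x / (real CARD('n))\<^sup>2)\<^sup>2 \<le> \<delta> / 2 * (x $ i - x $ j)\<^sup>2"
    using \<delta>(1) by (intro mult_left_mono) auto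
  also have "\<dots> \<le> (norm x)\<^sup>2 - (norm (A *v x))\<^sup>2"
    using norm_decrement_link[OF A \<delta>, of i j x] norm_decrement_link[OF A \<delta>, of j i x] ij
    by (auto simp: power2_commute)
  finally show ?thesis
    by (simp add: contraction_factor_def power_divide algebra_simps flip: power_mult)
qed

text \<open>The matrix serves to witness that \<delta> is at most 1: a diagonal entry is at most its
  row sum.\<close>

lemma contraction_factor_bounds:
  fixes A :: "real^'n^'n"
  assumes "doubly_stochastic A" "0 < \<delta>" "uniformly_positive \<delta> A"
  shows "0 < contraction_factor \<delta> CARD('n)" "contraction_factor \<delta> CARD('n) < 1"
proof -
  have "\<delta> \<le> A $ i $ i" for i using assms by (auto simp: uniformly_positive_def)
  also have "A $ i $ i \<le> (\<Sum>j\<in>UNIV. A $ i $ j)" for i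
    using assms(1) by (intro member_le_sum) (auto simp: doubly_stochastic_def)
  finally have "\<delta> \<le> 1" using assms(1) by (simp add: doubly_stochastic_def)
  moreover have "2 * real CARD('n) ^ 4 \<ge> 2" by (simp add: Suc_leI)
  ultimately have "\<delta> < 2 * real CARD('n) ^ 4" by linarith
  then show "0 < contraction_factor \<delta> CARD('n)" "contraction_factor \<delta> CARD('n) < 1"
    using assms(2) by (auto simp: contraction_factor_def field_simps)
qed

section \<open>Mean-zero vectors along the product\<close>

lemma doubly_stochastic_sum:
  fixes A :: "real^'n^'n"
  assumes A: "doubly_stochastic A"
  shows "(\<Sum>i\<in>UNIV. (A *v x) $ i) = (\<Sum>i\<in>UNIV. x $ i)"
proof -
  have "(\<Sum>i\<in>UNIV. (A *v x) $ i) = (\<Sum>j\<in>UNIV. (\<Sum>i\<in>UNIV. A $ i $ j) * x $ j)"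
    unfolding matrix_vector_mult_def by (simp add: sum_distrib_right) (rule sum.swap)
  then show ?thesis using A by (simp add: doubly_stochastic_def)
qed

lemma backward_product_step:
  "backward_product W (Suc k) \<omega> *v x = W (Suc k) \<omega> *v (backward_product W k \<omega> *v x)"
  by (simp add: matrix_vector_mul_assoc)

lemma backward_product_sum:
  assumes "\<And>t. t \<ge> 1 \<Longrightarrow> doubly_stochastic (W t \<omega>)"
  shows "(\<Sum>i\<in>UNIV. (backward_product W k \<omega> *v x) $ i) = (\<Sum>i\<in>UNIV. x $ i)"
proof (induction k)
  case (Suc k)
  then show ?case
    unfolding backward_product_step using doubly_stochastic_sum[OF assms[of "Suc k"]] by simp
qed simp

text \<open>
  \<open>T\<close> collects the times at which the current wide cut is crossed, and \<open>a j\<close> is the wide cut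
  in force after \<open>j\<close> crossings.
\<close>

lemma crossing_times:
  fixes W :: "nat \<Rightarrow> 'a \<Rightarrow> real^'n^'n"
  assumes N: "CARD('n) \<ge> 2" and mean: "(\<Sum>i\<in>UNIV. x $ i) = 0"
    and W: "\<And>t. t \<ge> 1 \<Longrightarrow> doubly_stochastic (W t \<omega>)"
    and \<delta>: "0 < \<delta>" "\<And>t. t \<ge> 1 \<Longrightarrow> uniformly_positive \<delta> (W t \<omega>)"
  shows "\<exists>T a. T \<subseteq> {1..k} \<and> (\<forall>j. a j \<in> proper_cuts) \<and>
    (\<forall>t\<in>{1..k} - T. respects_cut (W t \<omega>) (a (card (T \<inter> {1..t})))) \<and>
    wide_cut (a (card T)) (backward_product W k \<omega> *v x) \<and>
    (norm (backward_product W k \<omega> *v x))\<^sup>2 \<le> contraction_factor \<delta> CARD('n) ^ card T * (norm x)\<^sup>2"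
proof (induction k)
  case 0
  obtain S where "wide_cut S x" using wide_cut_exists[OF N mean] ..
  then show ?case
    by (intro exI[of _ "{}"] exI[of _ "\<lambda>_. S"]) (auto simp: wide_cut_def)
next
  case (Suc k)
  let ?\<rho> = "contraction_factor \<delta> CARD('n)"
  define y where "y = backward_product W k \<omega> *v x"
  define A where "A = W (Suc k) \<omega>"
  have A: "doubly_stochastic A" "uniformly_positive \<delta> A"
    using W \<delta> by (auto simp: A_def)
  have \<rho>: "0 < ?\<rho>" using contraction_factor_bounds[OF A(1) \<delta>(1) A(2)] by simp
  have step: "backward_product W (Suc k) \<omega> *v x = A *v y"
    unfolding backward_product_step y_def A_def ..
  obtain T a where T: "T \<subseteq> {1..k}" and a: "\<forall>j. a j \<in> proper_cuts"
    and resp: "\<forall>t\<in>{1..k} - T. respects_cut (W t \<omega>) (a (card (T \<inter> {1..t})))"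
    and wide: "wide_cut (a (card T)) y"
    and ny: "(norm y)\<^sup>2 \<le> ?\<rho> ^ card T * (norm x)\<^sup>2"
    using Suc.IH unfolding y_def by blast
  have finT: "finite T" using T finite_subset by blast
  have Tk: "T \<inter> {1..Suc k} = T" "Suc k \<notin> T" using T by auto
  have ivl: "{1..Suc k} = insert (Suc k) {1..k}" by auto
  show ?case
  proof (cases "respects_cut A (a (card T))")
    case True
    have "respects_cut (W t \<omega>) (a (card (T \<inter> {1..t})))" if "t \<in> {1..Suc k} - T" for t
    proof (cases "t = Suc k")
      case t: True
      show ?thesis using True unfolding t Tk(1) A_def .
    next
      case False
      then show ?thesis using that resp unfolding ivl by blast
    qed
    moreover have "(norm (A *v y))\<^sup>2 \<le> ?\<rho> ^ card T * (norm x)\<^sup>2"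
      by (rule order_trans[OF power_mono[OF norm_nonincreasing[OF A(1)]] ny]) simp
    moreover have "T \<subseteq> {1..Suc k}" using T by auto
    ultimately show ?thesis
      unfolding step using a wide_cut_respected[OF A(1) wide True] by blast
  next
    case False
    have "(\<Sum>i\<in>UNIV. (A *v y) $ i) = 0"
      using backward_product_sum[of W \<omega> "Suc k" x] W mean unfolding step by simp
    then obtain S where S: "wide_cut S (A *v y)" using wide_cut_exists[OF N] by blast
    define T' where "T' = insert (Suc k) T"
    define a' where "a' = a(card T' := S)"
    have cT': "card T' = Suc (card T)" using finT Tk by (simp add: T'_def)
    \<comment> \<open>Up to an earlier time there were at most \<open>card T\<close> crossings, so
      the new value of \<open>a'\<close> at \<open>card T'\<close> does not affect the earlier
      cuts.\<close>
    have "respects_cut (W t \<omega>) (a' (card (T' \<inter> {1..t})))" if "t \<in> {1..Suc k} - T'" for t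
    proof -
      have t: "t \<in> {1..k} - T" using that unfolding ivl T'_def by auto
      then have "T' \<inter> {1..t} = T \<inter> {1..t}" by (auto simp: T'_def)
      moreover have "card (T \<inter> {1..t}) \<le> card T" using finT by (intro card_mono) auto
      ultimately show ?thesis using resp t cT' by (simp add: a'_def)
    qed
    moreover have "(norm (A *v y))\<^sup>2 \<le> ?\<rho> ^ card T' * (norm x)\<^sup>2"
    proof -
      have "(norm (A *v y))\<^sup>2 \<le> ?\<rho> * (norm y)\<^sup>2"
        using wide_cut_crossed[OF A(1) \<delta>(1) A(2) wide False] .
      also have "\<dots> \<le> ?\<rho> * (?\<rho> ^ card T * (norm x)\<^sup>2)"
        using ny \<rho> by (intro mult_left_mono) auto
      finally show ?thesis by (simp add: cT' algebra_simps)
    qed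
    moreover have "T' \<subseteq> {1..Suc k}" using T by (auto simp: T'_def)
    moreover have "\<forall>j. a' j \<in> proper_cuts" using a S by (auto simp: a'_def wide_cut_def)
    moreover have "wide_cut (a' (card T')) (A *v y)" using S by (simp add: a'_def)
    ultimately show ?thesis unfolding step by blast
  qed
qed

section \<open>Deterministic bounds on the distance to consensus\<close>

lemma doubly_stochastic_averaging:
  fixes A :: "real^'n^'n"
  assumes "doubly_stochastic A"
  shows "A *v (\<chi> i. c) = (\<chi> i. c)"
  using assms by (simp add: vec_eq_iff matrix_vector_mult_def doubly_stochastic_def
      flip: sum_distrib_right)

lemma averaging_matrix_mult:
  fixes x :: "real^'n"
  shows "averaging_matrix *v x = (\<chi> i. (\<Sum>j\<in>UNIV. x $ j) / real CARD('n))"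
  by (simp add: vec_eq_iff matrix_vector_mult_def averaging_matrix_def sum_divide_distrib)

lemma doubly_stochastic_averaging_matrix: "doubly_stochastic (averaging_matrix :: real^'n^'n)"
  by (simp add: doubly_stochastic_def averaging_matrix_def)

text \<open>Subtracting the mean \<open>c\<close> is an orthogonal projection; the squared norm
  drops by \<open>N\<close> times the square of \<open>c\<close>.\<close>

lemma norm_deviation_from_mean_le:
  "norm (x - averaging_matrix *v x) \<le> norm (x :: real^'n)"
proof -
  define c where "c = (\<Sum>j\<in>UNIV. x $ j) / real CARD('n)"
  have s: "(\<Sum>j\<in>UNIV. x $ j) = c * real CARD('n)" by (simp add: c_def)
  have "(norm (x - averaging_matrix *v x))\<^sup>2 = (\<Sum>i\<in>UNIV. (x $ i - c)\<^sup>2)"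
    by (simp add: norm_sq_cart averaging_matrix_mult c_def)
  also have "\<dots> = (\<Sum>i\<in>UNIV. (x $ i)\<^sup>2) - 2 * c * (\<Sum>i\<in>UNIV. x $ i) + real CARD('n) * c\<^sup>2"
    by (simp add: power2_diff sum.distrib sum_subtractf sum_distrib_left algebra_simps)
  also have "\<dots> = (norm x)\<^sup>2 - real CARD('n) * c\<^sup>2"
    by (simp add: norm_sq_cart s) (simp add: power2_eq_square)
  also have "\<dots> \<le> (norm x)\<^sup>2" by simp
  finally show ?thesis by (simp add: power2_le_iff_abs_le)
qed

text \<open>The product fixes constant vectors, so the distance to consensus can be read off from
  its action on mean-zero vectors, to which \<open>crossing_times\<close> applies.\<close>

lemma backward_product_deviation:
  fixes W :: "nat \<Rightarrow> 'a \<Rightarrow> real^'n^'n"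
  assumes W: "\<And>t. t \<ge> 1 \<Longrightarrow> doubly_stochastic (W t \<omega>)"
  shows "(backward_product W k \<omega> - averaging_matrix) *v x
    = backward_product W k \<omega> *v (x - averaging_matrix *v x)"
proof -
  have "backward_product W k \<omega> *v (\<chi> i. c) = (\<chi> i. c)" for c
    by (induction k)
      (simp_all del: backward_product.simps(2)
        add: backward_product_step doubly_stochastic_averaging[OF W])
  then show ?thesis
    by (simp add: matrix_vector_mult_diff_rdistrib matrix_vector_mult_diff_distrib
        averaging_matrix_mult)
qed

text \<open>The pair \<open>T\<close>, \<open>a\<close> of \<open>crossing_times\<close> depends on
  the vector. If every pair had more than \<open>m\<close> crossings, all mean-zero vectors would be
  shrunk by the same power of the contraction factor, and the spectral norm would be below
  \<epsilon>. Arguing by contradiction avoids choosing a vector that attains the norm.\<close>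

lemma far_from_consensus_crossings:
  fixes W :: "nat \<Rightarrow> 'a \<Rightarrow> real^'n^'n"
  assumes N: "CARD('n) \<ge> 2"
    and W: "\<And>t. t \<ge> 1 \<Longrightarrow> doubly_stochastic (W t \<omega>)"
    and \<delta>: "0 < \<delta>" "\<And>t. t \<ge> 1 \<Longrightarrow> uniformly_positive \<delta> (W t \<omega>)"
    and \<epsilon>: "0 < \<epsilon>" and m: "contraction_factor \<delta> CARD('n) ^ Suc m < \<epsilon>\<^sup>2"
    and far: "\<epsilon> \<le> spectral_norm (backward_product W k \<omega> - averaging_matrix)"
  shows "\<exists>T a. T \<subseteq> {1..k} \<and> card T \<le> m \<and> (\<forall>j. a j \<in> proper_cuts) \<and>
    (\<forall>t\<in>{1..k} - T. respects_cut (W t \<omega>) (a (card (T \<inter> {1..t}))))"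
proof (rule ccontr)
  assume neg: "\<not> ?thesis"
  let ?\<rho> = "contraction_factor \<delta> CARD('n)"
  let ?B = "backward_product W k \<omega> - averaging_matrix"
  have \<rho>: "0 < ?\<rho>" "?\<rho> < 1"
    using contraction_factor_bounds[OF W[of 1] \<delta>(1) \<delta>(2)[of 1]] by auto
  have "norm (?B *v x) \<le> sqrt (?\<rho> ^ Suc m) * norm x" for x
  proof -
    define y where "y = x - averaging_matrix *v x"
    have "(\<Sum>i\<in>UNIV. y $ i) = 0"
      using doubly_stochastic_sum[OF doubly_stochastic_averaging_matrix, of x]
      by (simp add: y_def sum_subtractf)
    then obtain T a where T: "T \<subseteq> {1..k}" "\<forall>j. a j \<in> proper_cuts"
        "\<forall>t\<in>{1..k} - T. respects_cut (W t \<omega>) (a (card (T \<inter> {1..t})))"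
      and ny: "(norm (backward_product W k \<omega> *v y))\<^sup>2 \<le> ?\<rho> ^ card T * (norm y)\<^sup>2"
      using crossing_times[of y W \<omega> \<delta> k] N W \<delta> by blast
    have dev: "?B *v x = backward_product W k \<omega> *v y"
      using backward_product_deviation[of W \<omega> k x] W by (simp add: y_def)
    have "card T \<ge> Suc m" using neg T by (metis not_less_eq_eq)
    then have "?\<rho> ^ card T \<le> ?\<rho> ^ Suc m" using \<rho> by (intro power_decreasing) auto
    then have "(norm (?B *v x))\<^sup>2 \<le> ?\<rho> ^ Suc m * (norm x)\<^sup>2"
      using ny norm_deviation_from_mean_le[of x] \<rho>
        mult_mono[of "?\<rho> ^ card T" "?\<rho> ^ Suc m" "(norm y)\<^sup>2" "(norm x)\<^sup>2"]
      by (simp add: dev y_def power_mono)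
    then show ?thesis
      by (metis real_le_rsqrt real_sqrt_mult real_sqrt_abs abs_norm_cancel)
  qed
  then have "spectral_norm ?B \<le> sqrt (?\<rho> ^ Suc m)"
    unfolding spectral_norm_def by (rule onorm_le)
  with far have "\<epsilon> \<le> sqrt (?\<rho> ^ Suc m)" by linarith
  then have "\<epsilon>\<^sup>2 \<le> (sqrt (?\<rho> ^ Suc m))\<^sup>2"
    using \<epsilon> by (intro power_mono) auto
  also have "\<dots> = ?\<rho> ^ Suc m" using \<rho> by (intro real_sqrt_pow2) auto
  finally show False using m by linarith
qed

lemma respects_cut_spectral_norm:
  fixes W :: "nat \<Rightarrow> 'a \<Rightarrow> real^'n^'n"
  assumes W: "\<And>t. t \<ge> 1 \<Longrightarrow> doubly_stochastic (W t \<omega>)"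
    and S: "S \<in> proper_cuts" and resp: "\<And>t. t \<in> {1..k} \<Longrightarrow> respects_cut (W t \<omega>) S"
  shows "1 \<le> spectral_norm (backward_product W k \<omega> - averaging_matrix)"
proof -
  \<comment> \<open>Each side carries the size of the other side, which makes the mean 0. Both
    values are nonzero for a proper cut.\<close>
  define x :: "real^'n" where
    "x = (\<chi> i. if i \<in> S then real (card (- S)) else - real (card S))"
  have mean: "(\<Sum>i\<in>UNIV. x $ i) = 0"
  proof -
    have "(\<Sum>i\<in>UNIV. x $ i) = (\<Sum>i\<in>S. x $ i) + (\<Sum>i\<in>-S. x $ i)"
      by (metis Compl_eq_Diff_UNIV add.commute finite sum.subset_diff top_greatest)
    then show ?thesis by (simp add: x_def)
  qed
  obtain i where "i \<in> S" using S by (auto simp: proper_cuts_def)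
  moreover have "-S \<noteq> {}" using S by (auto simp: proper_cuts_def)
  ultimately have "x $ i \<noteq> 0" by (simp add: x_def)
  then have x: "norm x > 0" by auto
  have fix1: "A *v x = x" if A: "doubly_stochastic A" "respects_cut A S" for A
  proof -
    have row: "\<And>i. (\<Sum>j\<in>UNIV. A $ i $ j) = 1" using A by (auto simp: doubly_stochastic_def)
    have "A $ i $ j * x $ j = A $ i $ j * x $ i" for i j
      using A(2) by (cases "i \<in> S"; cases "j \<in> S") (auto simp: x_def respects_cut_def)
    then have "(A *v x) $ i = (\<Sum>j\<in>UNIV. A $ i $ j * x $ i)" for i
      unfolding matrix_vector_mult_def by (simp only: vec_lambda_beta)
    then show ?thesis
      by (simp add: vec_eq_iff row flip: sum_distrib_right)
  qed
  have "l \<le> k \<Longrightarrow> backward_product W l \<omega> *v x = x" for l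
  proof (induction l)
    case (Suc l)
    then show ?case
      unfolding backward_product_step using fix1[OF W resp, of "Suc l"] by simp
  qed simp
  then have "(backward_product W k \<omega> - averaging_matrix) *v x = x"
    by (simp add: matrix_vector_mult_diff_rdistrib averaging_matrix_mult mean zero_vec_def[symmetric])
  then have "norm x \<le> spectral_norm (backward_product W k \<omega> - averaging_matrix) * norm x"
    unfolding spectral_norm_def by (metis onorm matrix_vector_mul_bounded_linear)
  then show ?thesis using x by simp
qed

section \<open>Measurability\<close>

text \<open>By the triangle inequality the norm changes by at most the sum of the absolute changes
  of the entries. Continuity is needed for the measurability of the distance to consensus.\<close>

lemma continuous_on_spectral_norm: "continuous_on S (spectral_norm :: real^'n^'n \<Rightarrow> real)"
proof -
  have le: "spectral_norm A - spectral_norm B \<le> (\<Sum>i\<in>UNIV. \<Sum>j\<in>UNIV. \<bar>A $ i $ j - B $ i $ j\<bar>)"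
    for A B :: "real^'n^'n"
  proof -
    have "spectral_norm A \<le> spectral_norm (A - B) + spectral_norm B"
      using onorm_triangle[of "(*v) (A - B)" "(*v) B"]
      unfolding spectral_norm_def by (simp add: matrix_vector_mult_diff_rdistrib)
    moreover have "spectral_norm (A - B) \<le> (\<Sum>i\<in>UNIV. \<Sum>j\<in>UNIV. \<bar>A $ i $ j - B $ i $ j\<bar>)"
      using onorm_le_matrix_component_sum[of "A - B"] by (simp add: spectral_norm_def)
    ultimately show ?thesis by linarith
  qed
  have "(spectral_norm \<longlongrightarrow> spectral_norm A) (at A within S)" for A :: "real^'n^'n"
  proof (rule Lim_transform2[OF tendsto_const])
    have "((\<lambda>B. \<Sum>i\<in>UNIV. \<Sum>j\<in>UNIV. \<bar>B $ i $ j - A $ i $ j\<bar>) \<longlongrightarrow>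
        (\<Sum>i\<in>UNIV. \<Sum>j\<in>UNIV. \<bar>A $ i $ j - A $ i $ j\<bar>)) (at A within S)"
      by (intro tendsto_intros)
    then have 0: "((\<lambda>B. \<Sum>i\<in>UNIV. \<Sum>j\<in>UNIV. \<bar>B $ i $ j - A $ i $ j\<bar>) \<longlongrightarrow> 0) (at A within S)"
      by simp
    show "((\<lambda>B. spectral_norm A - spectral_norm B) \<longlongrightarrow> 0) (at A within S)"
    proof (rule Lim_null_comparison[OF _ 0], rule always_eventually, rule allI)
      fix B
      show "norm (spectral_norm A - spectral_norm B)
          \<le> (\<Sum>i\<in>UNIV. \<Sum>j\<in>UNIV. \<bar>B $ i $ j - A $ i $ j\<bar>)"
        using le[of A B] le[of B A] by (simp add: abs_le_iff abs_minus_commute)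
    qed
  qed
  then show ?thesis by (simp add: continuous_on_def)
qed

lemma continuous_on_matrix_product:
  "continuous_on S (\<lambda>P. (fst P :: real^'n^'n) ** (snd P :: real^'n^'n))"
  unfolding matrix_matrix_mult_def by (intro continuous_intros)

lemma backward_product_measurable:
  fixes W :: "nat \<Rightarrow> 'a \<Rightarrow> real^'n^'n"
  assumes "\<And>t. t \<ge> 1 \<Longrightarrow> W t \<in> borel_measurable M"
  shows "backward_product W k \<in> borel_measurable M"
proof (induction k)
  case 0
  show ?case by (simp add: fun_eq_iff cong: measurable_cong)
next
  case (Suc k)
  have "(\<lambda>\<omega>. W (Suc k) \<omega> ** backward_product W k \<omega>) \<in> borel_measurable M"
    by (rule borel_measurable_continuous_Pair[OF assms Suc continuous_on_matrix_product]) simp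
  then show ?case by (simp cong: measurable_cong)
qed

text \<open>In the lower bound this set is the larger one of an inclusion, so monotonicity of the
  measure requires it to be an event.\<close>

lemma far_from_consensus_measurable:
  fixes W :: "nat \<Rightarrow> 'a \<Rightarrow> real^'n^'n"
  assumes "\<And>t. t \<ge> 1 \<Longrightarrow> W t \<in> borel_measurable M"
  shows "{\<omega> \<in> space M. spectral_norm (backward_product W k \<omega> - averaging_matrix) \<ge> \<epsilon>} \<in> sets M"
proof -
  have "(\<lambda>\<omega>. backward_product W k \<omega> - averaging_matrix) \<in> borel_measurable M"
    using backward_product_measurable[OF assms] by measurable
  then have "(\<lambda>\<omega>. spectral_norm (backward_product W k \<omega> - averaging_matrix)) \<in> borel_measurable M"
    using borel_measurable_continuous_onI[OF continuous_on_spectral_norm]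
    by (rule measurable_compose)
  then show ?thesis by measurable
qed

lemma respects_cut_borel: "{A :: real^'n^'n. respects_cut A S} \<in> sets borel"
proof -
  have "{A :: real^'n^'n. respects_cut A S}
      = (\<Inter>i\<in>S. \<Inter>j\<in>-S. {A. A $ i $ j = 0} \<inter> {A. A $ j $ i = 0})"
    by (auto simp: respects_cut_def)
  moreover have "closed {A :: real^'n^'n. A $ i $ j = 0}" for i j
    by (intro closed_Collect_eq continuous_intros)
  ultimately show ?thesis by (auto intro!: borel_closed closed_INT closed_Int)
qed

section \<open>Crossing links and disconnected graphs\<close>

definition crossing_links :: "'n set \<Rightarrow> 'n graph" where
  "crossing_links S = {{i, j} |i j. i \<in> S \<and> j \<in> -S}"

text \<open>If \<open>v\<close> is not reachable from \<open>u\<close>, the vertices reachable from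
  \<open>u\<close> form the cut. Conversely, a path cannot leave \<open>S\<close> without using a
  crossing link.\<close>

lemma disconnected_iff_cut:
  "\<not> connected_graph E \<longleftrightarrow> (\<exists>S\<in>proper_cuts. E \<inter> crossing_links S = {})"
proof
  let ?R = "{(i, j). {i, j} \<in> E}"
  assume "\<not> connected_graph E"
  then obtain u v where uv: "(u, v) \<notin> ?R\<^sup>*" by (auto simp: connected_graph_def)
  define S where "S = {w. (u, w) \<in> ?R\<^sup>*}"
  have "u \<in> S" "v \<notin> S" using uv by (auto simp: S_def)
  then have "S \<in> proper_cuts" by (auto simp: proper_cuts_def)
  moreover have "E \<inter> crossing_links S = {}"
    by (auto simp: crossing_links_def S_def dest: rtrancl_into_rtrancl)
  ultimately show "\<exists>S\<in>proper_cuts. E \<inter> crossing_links S = {}" ..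
next
  let ?R = "{(i, j). {i, j} \<in> E}"
  assume "\<exists>S\<in>proper_cuts. E \<inter> crossing_links S = {}"
  then obtain S where S: "S \<in> proper_cuts" "E \<inter> crossing_links S = {}" ..
  obtain u v where uv: "u \<in> S" "v \<notin> S" using S(1) by (auto simp: proper_cuts_def)
  have "w \<in> S" if "(u, w) \<in> ?R\<^sup>*" for w
    using that
  proof (induction rule: rtrancl_induct)
    case (step y z)
    then show ?case using S(2) by (auto simp: crossing_links_def)
  qed (rule uv)
  with uv show "\<not> connected_graph E" unfolding connected_graph_def by blast
qed

lemma respects_cut_iff_induced_graph:
  fixes A :: "real^'n^'n"
  assumes "doubly_stochastic A"
  shows "respects_cut A S \<longleftrightarrow> induced_graph A \<inter> crossing_links S = {}"
proof -
  have "\<not> A $ i $ j > 0 \<longleftrightarrow> A $ i $ j = 0" for i j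
    using assms unfolding doubly_stochastic_def by (metis less_irrefl order_le_less)
  moreover have "{i, j} \<in> induced_graph A \<longleftrightarrow> i \<noteq> j \<and> (A $ i $ j > 0 \<or> A $ j $ i > 0)" for i j
    by (auto simp: induced_graph_def doubleton_eq_iff)
  moreover have "induced_graph A \<inter> crossing_links S = {}
      \<longleftrightarrow> (\<forall>i\<in>S. \<forall>j\<in>-S. {i, j} \<notin> induced_graph A)"
    unfolding crossing_links_def by blast
  ultimately show ?thesis unfolding respects_cut_def by (metis ComplD)
qed

section \<open>The link failure model\<close>

text \<open>Independence passes to complements through the sigma-algebras generated by the single
  events. The empty \<open>F\<close> is treated apart, since the product rule is stated for nonempty
  index sets.\<close>

lemma (in prob_space) prob_none_occur:
  assumes indep: "indep_events X I" and F: "F \<subseteq> I" "finite F"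
  shows "{\<omega> \<in> space M. \<forall>e\<in>F. \<omega> \<notin> X e} \<in> events"
    and "prob {\<omega> \<in> space M. \<forall>e\<in>F. \<omega> \<notin> X e} = (\<Prod>e\<in>F. 1 - prob (X e))"
proof -
  have X: "X e \<in> events" if "e \<in> F" for e
    using indep F that by (auto simp: indep_events_def)
  have eq: "{\<omega> \<in> space M. \<forall>e\<in>F. \<omega> \<notin> X e} = (\<Inter>e\<in>F. space M - X e)" if "F \<noteq> {}"
    using that by auto
  have "indep_sets (\<lambda>i. sigma_sets (space M) {X i}) I"
    using indep unfolding indep_events_def_alt
    by (rule indep_sets_sigma) (simp add: Int_stable_def)
  then have p: "prob (\<Inter>e\<in>F. space M - X e) = (\<Prod>e\<in>F. prob (space M - X e))" if "F \<noteq> {}"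
  proof (rule indep_setsD[OF _ F(1) that F(2)])
    show "\<forall>e\<in>F. space M - X e \<in> sigma_sets (space M) {X e}"
      by (intro ballI sigma_sets.Compl sigma_sets.Basic) simp
  qed
  show "prob {\<omega> \<in> space M. \<forall>e\<in>F. \<omega> \<notin> X e} = (\<Prod>e\<in>F. 1 - prob (X e))"
  proof (cases "F = {}")
    case True
    then show ?thesis by (simp add: prob_space)
  next
    case False
    have "(\<Prod>e\<in>F. prob (space M - X e)) = (\<Prod>e\<in>F. 1 - prob (X e))"
      using X by (intro prod.cong) (auto simp: prob_compl)
    then show ?thesis unfolding eq[OF False] p[OF False] .
  qed
  show "{\<omega> \<in> space M. \<forall>e\<in>F. \<omega> \<notin> X e} \<in> events"
  proof (cases "F = {}")
    case False
    show ?thesis unfolding eq[OF False] using X F(2) False by (intro sets.finite_INT) auto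
  qed simp
qed

lemma (in prob_space) prob_links_absent:
  fixes E :: "'n::finite graph"
  assumes G: "link_failure_model M E p G" and F: "F \<subseteq> E"
  shows "{\<omega> \<in> space M. G \<omega> \<inter> F = {}} \<in> events"
    and "prob {\<omega> \<in> space M. G \<omega> \<inter> F = {}} = (\<Prod>e\<in>F. 1 - p e)"
proof -
  let ?X = "\<lambda>e. {\<omega> \<in> space M. e \<in> G \<omega>}"
  have indep: "indep_events ?X E" using G by (simp add: link_failure_model_def)
  have eq: "{\<omega> \<in> space M. G \<omega> \<inter> F = {}} = {\<omega> \<in> space M. \<forall>e\<in>F. \<omega> \<notin> ?X e}" by auto
  show "{\<omega> \<in> space M. G \<omega> \<inter> F = {}} \<in> events"
    unfolding eq by (rule prob_none_occur(1)[OF indep F]) simp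
  have "prob {\<omega> \<in> space M. G \<omega> \<inter> F = {}} = (\<Prod>e\<in>F. 1 - prob (?X e))"
    unfolding eq by (rule prob_none_occur(2)[OF indep F]) simp
  also have "\<dots> = (\<Prod>e\<in>F. 1 - p e)"
    using G F by (intro prod.cong) (auto simp: link_failure_model_def)
  finally show "prob {\<omega> \<in> space M. G \<omega> \<inter> F = {}} = (\<Prod>e\<in>F. 1 - p e)" .
qed

text \<open>Realizations lie inside \<open>E\<close>, so \<open>G \<omega> = H\<close> is decided by
  the finitely many link events of \<open>E\<close>. This gives measurability, and the events for
  distinct \<open>H\<close> are disjoint.\<close>

lemma (in prob_space) collection_prob_eq:
  fixes E :: "'n::finite graph"
  assumes G: "link_failure_model M E p G" and H: "\<H> \<subseteq> realizable_graphs E"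
  shows "{\<omega> \<in> space M. G \<omega> \<in> \<H>} \<in> events"
    and "collection_prob M G \<H> = prob {\<omega> \<in> space M. G \<omega> \<in> \<H>}"
proof -
  have X: "{\<omega> \<in> space M. e \<in> G \<omega>} \<in> events" if "e \<in> E" for e
    using G that by (auto simp: link_failure_model_def indep_events_def)
  have "{\<omega> \<in> space M. (e \<in> G \<omega>) = (e \<in> H)} \<in> events" if "e \<in> E" for e H
    using X[OF that] by (cases "e \<in> H") (auto simp: sets.sets_Collect_neg)
  then have "{\<omega> \<in> space M. \<forall>e\<in>E. (e \<in> G \<omega>) = (e \<in> H)} \<in> events" for H
    by (intro sets.sets_Collect_finite_All) auto
  moreover have "{\<omega> \<in> space M. G \<omega> = H} = {\<omega> \<in> space M. \<forall>e\<in>E. (e \<in> G \<omega>) = (e \<in> H)}"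
    if "H \<in> \<H>" for H
    using G H that by (fastforce simp: link_failure_model_def realizable_graphs_def)
  ultimately have meas: "{\<omega> \<in> space M. G \<omega> = H} \<in> events" if "H \<in> \<H>" for H
    using that by auto
  have un: "{\<omega> \<in> space M. G \<omega> \<in> \<H>} = (\<Union>H\<in>\<H>. {\<omega> \<in> space M. G \<omega> = H})" by auto
  have fin: "finite \<H>" by (rule finite_subset[OF subset_UNIV]) simp
  show "{\<omega> \<in> space M. G \<omega> \<in> \<H>} \<in> events" unfolding un using fin meas by auto
  show "collection_prob M G \<H> = prob {\<omega> \<in> space M. G \<omega> \<in> \<H>}"
    unfolding un collection_prob_def using fin meas
    by (intro finite_measure_finite_Union[symmetric]) (auto simp: disjoint_family_on_def)
qed

text \<open>An inclusion-maximal element above the given collection exists by finiteness. Any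
  further graph must make the union connected, since otherwise it could be added.\<close>

lemma max_disconnected_collection_extends:
  fixes E :: "'n::finite graph"
  assumes "\<H>\<^sub>0 \<noteq> {}" "\<H>\<^sub>0 \<subseteq> \<G>" "\<not> connected_graph (\<Union>\<H>\<^sub>0)" "\<G> = realizable_graphs E"
  obtains \<H> where "\<H>\<^sub>0 \<subseteq> \<H>" "\<H> \<in> max_disconnected_collections \<G>"
proof -
  let ?A = "{\<H>. \<H> \<subseteq> \<G> \<and> \<not> connected_graph (\<Union>\<H>)}"
  have "finite ?A" by simp
  moreover have "\<H>\<^sub>0 \<in> ?A" using assms by simp
  ultimately have "\<exists>\<H>\<in>?A. \<H>\<^sub>0 \<subseteq> \<H> \<and> (\<forall>\<K>\<in>?A. \<H> \<subseteq> \<K> \<longrightarrow> \<H> = \<K>)"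
    by (rule finite_has_maximal2)
  then obtain \<H> where \<H>: "\<H> \<in> ?A" "\<H>\<^sub>0 \<subseteq> \<H>" "\<forall>\<K>\<in>?A. \<H> \<subseteq> \<K> \<longrightarrow> \<H> = \<K>"
    by (elim bexE conjE)
  have "connected_graph (\<Union>(\<H> \<union> {G}))" if G: "G \<in> \<G> - \<H>" for G
  proof (rule ccontr)
    assume "\<not> connected_graph (\<Union>(\<H> \<union> {G}))"
    then have "\<H> \<union> {G} \<in> ?A" using \<H>(1) G by simp
    then have "\<H> = \<H> \<union> {G}" using \<H>(3) by (metis Un_upper1)
    then show False using G by blast
  qed
  moreover have "\<H> \<noteq> {}" using \<H>(2) assms(1) by auto
  ultimately have "\<H> \<in> max_disconnected_collections \<G>"
    using \<H>(1) by (simp add: max_disconnected_collections_def)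
  with \<H>(2) show ?thesis by (rule that)
qed

text \<open>
  The links missing from a disconnected collection disconnect the graph, and the realizations
  without a given disconnecting set of links form a disconnected collection.
\<close>

lemma (in prob_space) p_max_eq:
  fixes E :: "'n::finite graph"
  assumes N: "CARD('n) \<ge> 2"
    and G: "link_failure_model M E p G"
    and F: "F \<subseteq> E" "\<not> connected_graph (E - F)"
    and opt: "\<And>F'. F' \<subseteq> E \<Longrightarrow> \<not> connected_graph (E - F') \<Longrightarrow> (\<Prod>e\<in>F'. 1 - p e) \<le> (\<Prod>e\<in>F. 1 - p e)"
  shows "p_max M G (realizable_graphs E) = (\<Prod>e\<in>F. 1 - p e)"
proof -
  let ?M = "max_disconnected_collections (realizable_graphs E)"
  have fin: "finite ?M" by simp
  have upper: "collection_prob M G \<H> \<le> (\<Prod>e\<in>F. 1 - p e)" if "\<H> \<in> ?M" for \<H>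
  proof -
    have \<H>: "\<H> \<subseteq> realizable_graphs E" "\<not> connected_graph (\<Union>\<H>)"
      using that by (auto simp: max_disconnected_collections_def)
    define F' where "F' = E - \<Union>\<H>"
    have "E - F' = \<Union>\<H>" using \<H>(1) by (auto simp: F'_def realizable_graphs_def)
    then have F': "F' \<subseteq> E" "\<not> connected_graph (E - F')" using \<H>(2) by (auto simp: F'_def)
    have "collection_prob M G \<H> \<le> prob {\<omega> \<in> space M. G \<omega> \<inter> F' = {}}"
      unfolding collection_prob_eq(2)[OF G \<H>(1)]
      by (rule finite_measure_mono[OF _ prob_links_absent(1)[OF G F'(1)]]) (auto simp: F'_def)
    also have "\<dots> = (\<Prod>e\<in>F'. 1 - p e)" by (rule prob_links_absent(2)[OF G F'(1)])
    also have "\<dots> \<le> (\<Prod>e\<in>F. 1 - p e)" by (rule opt[OF F'])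
    finally show ?thesis .
  qed
  \<comment> \<open>All realizations that avoid \<open>F\<close>; their union is
    \<open>E - F\<close>. This collection may fail to be maximal, hence the extension.\<close>
  let ?H0 = "Pow (E - F)"
  have "?H0 \<noteq> {}" "?H0 \<subseteq> realizable_graphs E" "\<not> connected_graph (\<Union>?H0)"
    using F by (auto simp: realizable_graphs_def)
  then obtain \<H> where \<H>: "?H0 \<subseteq> \<H>" "\<H> \<in> ?M"
    by (rule max_disconnected_collection_extends[OF _ _ _ refl])
  then have sub: "\<H> \<subseteq> realizable_graphs E" by (auto simp: max_disconnected_collections_def)
  have "(\<Prod>e\<in>F. 1 - p e) = prob {\<omega> \<in> space M. G \<omega> \<inter> F = {}}"
    by (rule prob_links_absent(2)[OF G F(1), symmetric])
  also have "\<dots> \<le> prob {\<omega> \<in> space M. G \<omega> \<in> \<H>}"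
  proof (rule finite_measure_mono[OF _ collection_prob_eq(1)[OF G sub]])
    show "{\<omega> \<in> space M. G \<omega> \<inter> F = {}} \<subseteq> {\<omega> \<in> space M. G \<omega> \<in> \<H>}"
      using \<H>(1) G by (auto simp: link_failure_model_def realizable_graphs_def)
  qed
  also have "\<dots> = collection_prob M G \<H>" by (rule collection_prob_eq(2)[OF G sub, symmetric])
  finally have "(\<Prod>e\<in>F. 1 - p e) \<le> collection_prob M G \<H>" .
  moreover have "collection_prob M G \<H> \<le> (\<Prod>e\<in>F. 1 - p e)" by (rule upper[OF \<H>(2)])
  ultimately have "collection_prob M G \<H> = (\<Prod>e\<in>F. 1 - p e)" by (rule antisym[rotated])
  then show ?thesis
    unfolding p_max_def using fin upper \<H>(2) by (intro Max_eqI) (auto intro!: image_eqI)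
qed

section \<open>Minimum cuts\<close>

lemma ereal_exp_ln: "0 \<le> q \<Longrightarrow> ereal_exp (ereal_ln q) = ereal q"
  by (auto simp: ereal_exp_def ereal_ln_def)

lemma ereal_ln_le_iff: "0 \<le> x \<Longrightarrow> 0 \<le> y \<Longrightarrow> ereal_ln x \<le> ereal_ln y \<longleftrightarrow> x \<le> y"
  by (auto simp: ereal_ln_def)

text \<open>A factor 0 makes its summand, and hence the sum, infinite. No summand is minus infinity,
  so no indeterminate sum arises.\<close>

lemma sum_neg_ereal_ln:
  assumes "finite F" "\<And>e. e \<in> F \<Longrightarrow> 0 \<le> x e"
  shows "(\<Sum>e\<in>F. - ereal_ln (x e)) = - ereal_ln (\<Prod>e\<in>F. x e)"
  using assms
proof (induction F rule: finite_induct)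
  case empty
  show ?case by (simp add: ereal_ln_def)
next
  case (insert e F)
  have "0 \<le> (\<Prod>e\<in>F. x e)" using insert by (intro prod_nonneg) auto
  moreover have "0 \<le> x e" using insert by auto
  ultimately have "- ereal_ln (x e) + - ereal_ln (\<Prod>e\<in>F. x e) = - ereal_ln (x e * (\<Prod>e\<in>F. x e))"
    by (auto simp: ereal_ln_def ln_mult mult_le_0_iff)
  then show ?case using insert by simp
qed

lemma entry_at_neg_log_link_prob:
  assumes "{i, j} \<in> E"
  shows "entry_at (neg_log_one_minus (link_prob_matrix E p)) {i, j} = - ereal_ln (1 - p {i, j})"
proof -
  have "transpose (neg_log_one_minus (link_prob_matrix E p)) = neg_log_one_minus (link_prob_matrix E p)"
    by (simp add: vec_eq_iff transpose_def neg_log_one_minus_def link_prob_matrix_def insert_commute)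
  then show ?thesis
    using assms by (simp add: entry_at_symmetric) (simp add: neg_log_one_minus_def link_prob_matrix_def)
qed

text \<open>The logarithm turns costs into products and is increasing, so a cheapest disconnecting
  set maximizes the probability that all its links fail. The same \<open>F\<close> then serves for
  \<open>p_max\<close> and for the rate.\<close>

lemma mincut_optimal:
  fixes E :: "'n::finite graph"
  assumes N: "CARD('n) \<ge> 2" and E: "E \<subseteq> all_links"
    and p: "\<And>e. e \<in> E \<Longrightarrow> 0 \<le> p e \<and> p e \<le> 1"
  obtains F where "F \<subseteq> E" "\<not> connected_graph (E - F)"
    "mincut E (neg_log_one_minus (link_prob_matrix E p)) = - ereal_ln (\<Prod>e\<in>F. 1 - p e)"
    "\<And>F'. F' \<subseteq> E \<Longrightarrow> \<not> connected_graph (E - F') \<Longrightarrow> (\<Prod>e\<in>F'. 1 - p e) \<le> (\<Prod>e\<in>F. 1 - p e)"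
proof -
  let ?C = "neg_log_one_minus (link_prob_matrix E p)"
  let ?c = "\<lambda>F. \<Sum>e\<in>F. entry_at ?C e"
  let ?A = "{?c F |F. F \<subseteq> E \<and> \<not> connected_graph (E - F)}"
  have c: "?c F = - ereal_ln (\<Prod>e\<in>F. 1 - p e)" if "F \<subseteq> E" for F
  proof -
    have "entry_at ?C e = - ereal_ln (1 - p e)" if "e \<in> F" for e
    proof -
      have "e \<in> E" using that \<open>F \<subseteq> E\<close> by auto
      moreover obtain i j where "e = {i, j}"
        using E \<open>e \<in> E\<close> by (auto simp: all_links_def card_2_iff)
      ultimately show ?thesis using entry_at_neg_log_link_prob by metis
    qed
    then have "?c F = (\<Sum>e\<in>F. - ereal_ln (1 - p e))" by (rule sum.cong[OF refl])
    then show ?thesis using p that by (simp add: sum_neg_ereal_ln subset_iff)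
  qed
  note A = mincut_set_finite_nonempty[OF N, of ?C E]
  have "mincut E ?C \<in> ?A" unfolding mincut_def by (rule Min_in[OF A])
  then obtain F where F: "F \<subseteq> E" "\<not> connected_graph (E - F)" "mincut E ?C = ?c F" by blast
  have nonneg: "0 \<le> (\<Prod>e\<in>F. 1 - p e)" if "F \<subseteq> E" for F
    using p that by (intro prod_nonneg) auto
  show ?thesis
  proof (rule that[OF F(1,2)])
    show "mincut E ?C = - ereal_ln (\<Prod>e\<in>F. 1 - p e)" using F c by simp
    fix F' assume F': "F' \<subseteq> E" "\<not> connected_graph (E - F')"
    have "?c F \<le> ?c F'"
      unfolding F(3)[symmetric] mincut_def using F' by (intro Min_le[OF A(1)]) blast
    then show "(\<Prod>e\<in>F'. 1 - p e) \<le> (\<Prod>e\<in>F. 1 - p e)"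
      using c F F' nonneg by (simp add: ereal_ln_le_iff)
  qed
qed

section \<open>Probability of remaining far from consensus\<close>

text \<open>The cut may vary with time, as the crossing patterns of \<open>crossing_times\<close>
  require.\<close>

lemma (in prob_space) prob_respects_cuts:
  fixes W :: "nat \<Rightarrow> 'a \<Rightarrow> real^'n^'n"
  assumes indep: "indep_vars (\<lambda>_. borel) W I" and J: "J \<subseteq> I" "finite J"
  shows "{\<omega> \<in> space M. \<forall>t\<in>J. respects_cut (W t \<omega>) (a t)} \<in> events"
    and "prob {\<omega> \<in> space M. \<forall>t\<in>J. respects_cut (W t \<omega>) (a t)}
      = (\<Prod>t\<in>J. prob {\<omega> \<in> space M. respects_cut (W t \<omega>) (a t)})"
proof -
  let ?R = "\<lambda>t. {A :: real^'n^'n. respects_cut A (a t)}"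
  have rv: "W t \<in> borel_measurable M" if "t \<in> J" for t
    using indep J that by (auto simp: indep_vars_def)
  have R: "W t -` ?R t \<inter> space M = {\<omega> \<in> space M. respects_cut (W t \<omega>) (a t)}" for t
    by auto
  have "{\<omega> \<in> space M. respects_cut (W t \<omega>) (a t)} \<in> events" if "t \<in> J" for t
    using measurable_sets[OF rv[OF that] respects_cut_borel[of "a t"]] unfolding R .
  then show "{\<omega> \<in> space M. \<forall>t\<in>J. respects_cut (W t \<omega>) (a t)} \<in> events"
    using J(2) by (intro sets.sets_Collect_finite_All) auto
  show "prob {\<omega> \<in> space M. \<forall>t\<in>J. respects_cut (W t \<omega>) (a t)}
      = (\<Prod>t\<in>J. prob {\<omega> \<in> space M. respects_cut (W t \<omega>) (a t)})"
  proof (cases "J = {}")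
    case True
    then show ?thesis by (simp add: prob_space)
  next
    case False
    have "{\<omega> \<in> space M. \<forall>t\<in>J. respects_cut (W t \<omega>) (a t)} = (\<Inter>t\<in>J. W t -` ?R t \<inter> space M)"
      using False by auto
    moreover have "prob (\<Inter>t\<in>J. W t -` ?R t \<inter> space M) = (\<Prod>t\<in>J. prob (W t -` ?R t \<inter> space M))"
      using False J(2,1) respects_cut_borel by (intro indep_varsD[OF indep]) auto
    ultimately show ?thesis by (simp only: R)
  qed
qed

text \<open>Such a subset is listed by a word of length \<open>m\<close> over \<open>{0..k}\<close>,
  where 0 serves as padding and is removed afterwards.\<close>

lemma card_small_subsets_le:
  "card {T. T \<subseteq> {1..k} \<and> card T \<le> m} \<le> Suc k ^ m"
proof -
  have "{T. T \<subseteq> {1..k} \<and> card T \<le> m}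
      \<subseteq> (\<lambda>xs. set xs - {0}) ` {xs. set xs \<subseteq> {0..k} \<and> length xs = m}"
  proof clarify
    fix T assume T: "T \<subseteq> {1..k}" "card T \<le> m"
    obtain xs where xs: "set xs = T" "distinct xs"
      using finite_distinct_list[of T] T(1) finite_subset by blast
    then have "length xs \<le> m" using T(2) distinct_card by metis
    moreover have "0 \<notin> T" using T(1) by auto
    ultimately show "T \<in> (\<lambda>xs. set xs - {0}) ` {xs. set xs \<subseteq> {0..k} \<and> length xs = m}"
      using xs T(1) by (intro image_eqI[of _ _ "xs @ replicate (m - length xs) 0"])
        (auto simp: set_replicate_conv_if)
  qed
  then have "card {T. T \<subseteq> {1..k} \<and> card T \<le> m} \<le> card {xs. set xs \<subseteq> {0..k} \<and> length xs = m}"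
    by (intro surj_card_le) (auto simp: finite_lists_length_eq)
  then show ?thesis by (simp add: card_lists_length_eq)
qed

text \<open>Union bound over the patterns \<open>(T, a)\<close>. For a fixed pattern the events at
  the times outside \<open>T\<close> are independent, each has probability at most \<open>q\<close>,
  and at least \<open>k - m\<close> of them remain.\<close>

lemma (in prob_space) prob_far_from_consensus_le:
  fixes W :: "nat \<Rightarrow> 'a \<Rightarrow> real^'n^'n"
  assumes N: "CARD('n) \<ge> 2" and indep: "indep_vars (\<lambda>_. borel) W {1..}"
    and W: "\<And>t \<omega>. t \<ge> 1 \<Longrightarrow> \<omega> \<in> space M \<Longrightarrow> doubly_stochastic (W t \<omega>)"
    and \<delta>: "0 < \<delta>" "\<And>t \<omega>. t \<ge> 1 \<Longrightarrow> \<omega> \<in> space M \<Longrightarrow> uniformly_positive \<delta> (W t \<omega>)"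
    and cut: "\<And>t S. t \<ge> 1 \<Longrightarrow> S \<in> proper_cuts \<Longrightarrow> prob {\<omega> \<in> space M. respects_cut (W t \<omega>) S} \<le> q"
    and q: "0 \<le> q" "q \<le> 1" and \<epsilon>: "0 < \<epsilon>"
  shows "\<exists>m C. \<forall>k>0. prob {\<omega> \<in> space M. \<epsilon> \<le> spectral_norm (backward_product W k \<omega> - averaging_matrix)}
    \<le> C * real k ^ m * q ^ (k - m)"
proof -
  let ?\<rho> = "contraction_factor \<delta> CARD('n)"
  obtain \<omega>\<^sub>0 where \<omega>\<^sub>0: "\<omega>\<^sub>0 \<in> space M" using not_empty by auto
  have "doubly_stochastic (W 1 \<omega>\<^sub>0)" "uniformly_positive \<delta> (W 1 \<omega>\<^sub>0)"
    using W[of 1] \<delta>(2)[of 1] \<omega>\<^sub>0 by auto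
  then have \<rho>: "0 < ?\<rho>" "?\<rho> < 1"
    using contraction_factor_bounds \<delta>(1) by auto
  obtain m where "?\<rho> ^ m < \<epsilon>\<^sup>2"
    using real_arch_pow_inv[of "\<epsilon>\<^sup>2" ?\<rho>] \<rho> \<epsilon> by auto
  moreover have "?\<rho> ^ Suc m \<le> ?\<rho> ^ m" using \<rho> by (intro power_decreasing) auto
  ultimately have m: "?\<rho> ^ Suc m < \<epsilon>\<^sup>2" by linarith
  \<comment> \<open>At most \<open>m\<close> crossings occur, so only the values of \<open>a\<close>
    up to \<open>m\<close> matter. Restricting to them leaves finitely many choices, independently
    of \<open>k\<close>.\<close>
  define \<A> where "\<A> = PiE {..m} (\<lambda>_. proper_cuts :: 'n set set)"
  have fin\<A>: "finite \<A>" unfolding \<A>_def by (intro finite_PiE) auto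
  \<comment> \<open>The power of 2 absorbs the step from \<open>k + 1\<close> to
    \<open>2 * k\<close>, valid for positive \<open>k\<close>.\<close>
  define C where "C = real (card \<A>) * 2 ^ m"
  have "prob {\<omega> \<in> space M. \<epsilon> \<le> spectral_norm (backward_product W k \<omega> - averaging_matrix)}
      \<le> C * real k ^ m * q ^ (k - m)" if k: "k > 0" for k
  proof -
    let ?far = "{\<omega> \<in> space M. \<epsilon> \<le> spectral_norm (backward_product W k \<omega> - averaging_matrix)}"
    define \<T> where "\<T> = {T. T \<subseteq> {1..k} \<and> card T \<le> m}"
    have fin\<T>: "finite \<T>" unfolding \<T>_def by (rule finite_subset[of _ "Pow {1..k}"]) auto
    define B where "B = (\<lambda>(T, a). {\<omega> \<in> space M. \<forall>t\<in>{1..k} - T. respects_cut (W t \<omega>) (a (card (T \<inter> {1..t})))})"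
    have B: "B P \<in> events" for P
      unfolding B_def case_prod_beta by (rule prob_respects_cuts(1)[OF indep]) auto
    have card_le: "card (T \<inter> {1..t}) \<le> m" if "T \<in> \<T>" for T t
    proof -
      have "finite T" using that finite_subset by (auto simp: \<T>_def)
      then have "card (T \<inter> {1..t}) \<le> card T" by (intro card_mono) auto
      then show ?thesis using that by (simp add: \<T>_def)
    qed
    have sub: "?far \<subseteq> (\<Union>P\<in>\<T> \<times> \<A>. B P)"
    proof
      fix \<omega> assume \<omega>: "\<omega> \<in> ?far"
      then obtain T a where T: "T \<subseteq> {1..k}" "card T \<le> m" and a: "\<forall>j. a j \<in> proper_cuts"
        and resp: "\<forall>t\<in>{1..k} - T. respects_cut (W t \<omega>) (a (card (T \<inter> {1..t})))"
        using far_from_consensus_crossings[of W \<omega> \<delta> \<epsilon> m k] N W \<delta> \<epsilon> m by blast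
      have "T \<in> \<T>" using T by (simp add: \<T>_def)
      moreover have "restrict a {..m} \<in> \<A>" using a by (auto simp: \<A>_def)
      moreover have "\<omega> \<in> B (T, restrict a {..m})"
        using \<omega> resp card_le[OF \<open>T \<in> \<T>\<close>] by (simp add: B_def)
      ultimately show "\<omega> \<in> (\<Union>P\<in>\<T> \<times> \<A>. B P)" by blast
    qed
    have pB: "prob (B P) \<le> q ^ (k - m)" if P: "P \<in> \<T> \<times> \<A>" for P
    proof -
      obtain T a where Ta: "P = (T, a)" "T \<in> \<T>" "a \<in> \<A>" using P by auto
      have T: "T \<subseteq> {1..k}" "card T \<le> m" using Ta(2) by (auto simp: \<T>_def)
      have "prob (B P) = (\<Prod>t\<in>{1..k} - T. prob {\<omega> \<in> space M. respects_cut (W t \<omega>) (a (card (T \<inter> {1..t})))})"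
        unfolding B_def Ta(1) case_prod_conv by (rule prob_respects_cuts(2)[OF indep]) auto
      also have "\<dots> \<le> (\<Prod>t\<in>{1..k} - T. q)"
        using card_le[OF Ta(2)] Ta(3) cut by (intro prod_mono) (auto simp: \<A>_def PiE_iff)
      also have "\<dots> = q ^ (k - card T)"
        using T(1) finite_subset[OF T(1)] by (simp add: card_Diff_subset)
      also have "\<dots> \<le> q ^ (k - m)" using q T(2) by (intro power_decreasing) auto
      finally show ?thesis .
    qed
    have "prob ?far \<le> prob (\<Union>P\<in>\<T> \<times> \<A>. B P)"
      using sub B fin\<T> fin\<A> by (intro finite_measure_mono sets.finite_UN) auto
    also have "\<dots> \<le> (\<Sum>P\<in>\<T> \<times> \<A>. prob (B P))"
      using B fin\<T> fin\<A> by (intro finite_measure_subadditive_finite) auto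
    also have "\<dots> \<le> (\<Sum>P\<in>\<T> \<times> \<A>. q ^ (k - m))" by (intro sum_mono pB)
    also have "\<dots> = real (card \<T>) * real (card \<A>) * q ^ (k - m)" by (simp add: card_cartesian_product)
    also have "\<dots> \<le> (2 * real k) ^ m * real (card \<A>) * q ^ (k - m)"
    proof (intro mult_right_mono)
      have "real (card \<T>) \<le> real (Suc k ^ m)"
        unfolding \<T>_def of_nat_le_iff by (rule card_small_subsets_le)
      also have "\<dots> \<le> (2 * real k) ^ m" using k unfolding of_nat_power by (intro power_mono) auto
      finally show "real (card \<T>) \<le> (2 * real k) ^ m" .
    qed (use q in auto)
    finally show ?thesis by (simp add: C_def power_mult_distrib mult_ac)
  qed
  then show ?thesis by blast
qed

lemma (in prob_space) prob_far_from_consensus_ge: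
  fixes W :: "nat \<Rightarrow> 'a \<Rightarrow> real^'n^'n"
  assumes indep: "indep_vars (\<lambda>_. borel) W {1..}"
    and W: "\<And>t \<omega>. t \<ge> 1 \<Longrightarrow> \<omega> \<in> space M \<Longrightarrow> doubly_stochastic (W t \<omega>)"
    and S: "S \<in> proper_cuts"
    and cut: "\<And>t. t \<ge> 1 \<Longrightarrow> q \<le> prob {\<omega> \<in> space M. respects_cut (W t \<omega>) S}"
    and q: "0 \<le> q" and \<epsilon>: "\<epsilon> \<le> 1"
  shows "q ^ k \<le> prob {\<omega> \<in> space M. \<epsilon> \<le> spectral_norm (backward_product W k \<omega> - averaging_matrix)}"
proof -
  have rv: "\<And>t. t \<ge> 1 \<Longrightarrow> W t \<in> borel_measurable M"
    using indep by (auto simp: indep_vars_def)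
  have "q ^ k = (\<Prod>t\<in>{1..k}. q)" by simp
  also have "\<dots> \<le> (\<Prod>t\<in>{1..k}. prob {\<omega> \<in> space M. respects_cut (W t \<omega>) S})"
    using q cut by (intro prod_mono) auto
  also have "\<dots> = prob {\<omega> \<in> space M. \<forall>t\<in>{1..k}. respects_cut (W t \<omega>) S}"
    by (rule prob_respects_cuts(2)[OF indep, symmetric]) auto
  also have "\<dots> \<le> prob {\<omega> \<in> space M. \<epsilon> \<le> spectral_norm (backward_product W k \<omega> - averaging_matrix)}"
  proof (rule finite_measure_mono[OF _ far_from_consensus_measurable[OF rv]])
    show "{\<omega> \<in> space M. \<forall>t\<in>{1..k}. respects_cut (W t \<omega>) S}
        \<subseteq> {\<omega> \<in> space M. \<epsilon> \<le> spectral_norm (backward_product W k \<omega> - averaging_matrix)}"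
    proof clarify
      fix \<omega> assume \<omega>: "\<omega> \<in> space M" "\<forall>t\<in>{1..k}. respects_cut (W t \<omega>) S"
      have "1 \<le> spectral_norm (backward_product W k \<omega> - averaging_matrix)"
        using respects_cut_spectral_norm[of W \<omega> S k] W \<omega> S by simp
      then show "\<epsilon> \<le> spectral_norm (backward_product W k \<omega> - averaging_matrix)"
        using \<epsilon> by linarith
    qed
  qed
  finally show ?thesis .
qed

text \<open>After taking logarithms and dividing by \<open>k\<close>, the polynomial factor and the
  shift of the exponent by \<open>m\<close> vanish in the limit.\<close>

lemma exponential_rate:
  fixes P :: "nat \<Rightarrow> real"
  assumes q: "0 \<le> q" and lower: "\<And>k. q ^ k \<le> P k"
    and upper: "\<And>k. k > 0 \<Longrightarrow> P k \<le> C * real k ^ m * q ^ (k - m)"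
  shows "(\<lambda>k. ereal (1 / real k) * ereal_ln (P k)) \<longlonglongrightarrow> ereal_ln q"
proof (cases "q = 0")
  case True
  \<comment> \<open>For \<open>q = 0\<close> the upper bound forces \<open>P k\<close> to be at most
    0 as soon as \<open>k\<close> exceeds \<open>m\<close>; before that, truncated subtraction makes
    the power of \<open>q\<close> equal to 1.\<close>
  have "eventually (\<lambda>k. ereal (1 / real k) * ereal_ln (P k) = ereal_ln q) sequentially"
    using eventually_gt_at_top[of m]
  proof eventually_elim
    case (elim k)
    then have "P k \<le> 0" using upper[of k] True by (simp add: power_0_left)
    then show ?case using elim True by (simp add: ereal_ln_def)
  qed
  then show ?thesis by (rule tendsto_eventually)
next
  case False
  then have q: "q > 0" using q by simp
  have P: "P k > 0" for k using lower[of k] q by (meson less_le_trans zero_less_power)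
  \<comment> \<open>The case \<open>k = 1\<close> of the two bounds already forces \<open>C\<close>
    to be positive, so that its logarithm can be split off.\<close>
  have "0 < C * q ^ (1 - m)" using upper[of 1] P[of 1] by simp
  then have C: "C > 0" using q by (simp add: zero_less_mult_iff)
  have "(\<lambda>k. ln (P k) / real k) \<longlonglongrightarrow> ln q"
  proof (rule tendsto_sandwich)
    show "eventually (\<lambda>k. ln q \<le> ln (P k) / real k) sequentially"
      using eventually_gt_at_top[of 0]
    proof eventually_elim
      case (elim k)
      have "ln (q ^ k) \<le> ln (P k)" using lower[of k] P[of k] q by simp
      then show ?case using elim q by (simp add: ln_realpow field_simps)
    qed
    show "eventually (\<lambda>k. ln (P k) / real k
        \<le> (ln C - real m * ln q) * (1 / real k) + real m * (ln (real k) / real k) + ln q) sequentially"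
      using eventually_gt_at_top[of m]
    proof eventually_elim
      case (elim k)
      then have k: "k > 0" by simp
      have "ln (P k) \<le> ln (C * real k ^ m * q ^ (k - m))"
        using upper[OF k] P[of k] C q k by simp
      also have "\<dots> = ln C + real m * ln (real k) + (real k - real m) * ln q"
        using C q k elim by (simp add: ln_mult ln_realpow of_nat_diff)
      finally have "ln (P k) / real k \<le> (ln C + real m * ln (real k) + (real k - real m) * ln q) / real k"
        by (rule divide_right_mono) simp
      then show ?case using k by (simp add: field_simps)
    qed
    have "(\<lambda>k. (ln C - real m * ln q) * (1 / real k) + real m * (ln (real k) / real k) + ln q)
        \<longlonglongrightarrow> (ln C - real m * ln q) * 0 + real m * 0 + ln q"
      by (intro tendsto_intros lim_1_over_n lim_ln_over_n)
    then show "(\<lambda>k. (ln C - real m * ln q) * (1 / real k) + real m * (ln (real k) / real k) + ln q)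
        \<longlonglongrightarrow> ln q" by simp
  qed simp
  then have "(\<lambda>k. ereal (ln (P k) / real k)) \<longlonglongrightarrow> ereal (ln q)" by simp
  \<comment> \<open>This includes \<open>k = 0\<close>, where division by zero makes both sides
    0.\<close>
  moreover have "ereal (1 / real k) * ereal_ln (P k) = ereal (ln (P k) / real k)" for k
    using P[of k] by (simp add: ereal_ln_def)
  ultimately show ?thesis using q by (simp add: ereal_ln_def)
qed

theorem lemma18:
  fixes M :: "'a measure"
    and W :: "nat \<Rightarrow> 'a \<Rightarrow> real^'n^'n"
    and E :: "'n graph"
    and p :: "'n set \<Rightarrow> real"
  assumes "CARD('n) \<ge> 2"
    and "E \<subseteq> all_links"
    and "\<And>e. e \<in> E \<Longrightarrow> 0 \<le> p e \<and> p e \<le> 1"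
    and "matrix_process M W"
    and "\<And>t. t \<ge> 1 \<Longrightarrow> link_failure_model M E p (\<lambda>\<omega>. induced_graph (W t \<omega>))"
  shows "(\<forall>t\<ge>1. ereal (p_max M (\<lambda>\<omega>. induced_graph (W t \<omega>)) (realizable_graphs E)) =
           ereal_exp (- mincut E (neg_log_one_minus (link_prob_matrix E p)))) \<and>
         has_consensus_rate M W (mincut E (neg_log_one_minus (link_prob_matrix E p)))"
proof -
  have "prob_space M" using assms(4) by (simp add: matrix_process_def)
  then interpret prob_space M .
  have indep: "indep_vars (\<lambda>_. borel) W {1..}"
    and W: "\<And>t \<omega>. t \<ge> 1 \<Longrightarrow> \<omega> \<in> space M \<Longrightarrow> doubly_stochastic (W t \<omega>)"
    using assms(4) by (auto simp: matrix_process_def)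
  have "\<exists>\<delta>>0. \<forall>t\<ge>1. \<forall>\<omega>\<in>space M. uniformly_positive \<delta> (W t \<omega>)"
    using assms(4) unfolding matrix_process_def uniformly_positive_def by (elim conjE)
  then obtain \<delta> where \<delta>: "0 < \<delta>"
      "\<And>t \<omega>. t \<ge> 1 \<Longrightarrow> \<omega> \<in> space M \<Longrightarrow> uniformly_positive \<delta> (W t \<omega>)"
    by auto
  obtain F where F: "F \<subseteq> E" "\<not> connected_graph (E - F)"
    and mincut: "mincut E (neg_log_one_minus (link_prob_matrix E p)) = - ereal_ln (\<Prod>e\<in>F. 1 - p e)"
    and opt: "\<And>F'. F' \<subseteq> E \<Longrightarrow> \<not> connected_graph (E - F') \<Longrightarrow> (\<Prod>e\<in>F'. 1 - p e) \<le> (\<Prod>e\<in>F. 1 - p e)"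
    by (rule mincut_optimal[of E p, OF assms(1-3)]) (auto intro: that)
  define q where "q = (\<Prod>e\<in>F. 1 - p e)"
  have q0: "0 \<le> q" unfolding q_def using F(1) assms(3) by (intro prod_nonneg) auto
  have q1: "q \<le> 1" unfolding q_def using F(1) assms(3) by (intro prod_le_1) auto
  have absent: "prob {\<omega> \<in> space M. respects_cut (W t \<omega>) S} = (\<Prod>e\<in>E \<inter> crossing_links S. 1 - p e)"
    if t: "t \<ge> 1" for t S
  proof -
    have "respects_cut (W t \<omega>) S \<longleftrightarrow> induced_graph (W t \<omega>) \<inter> (E \<inter> crossing_links S) = {}"
      if \<omega>: "\<omega> \<in> space M" for \<omega>
    proof -
      have "induced_graph (W t \<omega>) \<subseteq> E"
        using assms(5)[OF t] \<omega> by (simp add: link_failure_model_def realizable_graphs_def)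
      then show ?thesis
        unfolding respects_cut_iff_induced_graph[OF W[OF t \<omega>]] by blast
    qed
    then have "{\<omega> \<in> space M. respects_cut (W t \<omega>) S}
        = {\<omega> \<in> space M. induced_graph (W t \<omega>) \<inter> (E \<inter> crossing_links S) = {}}"
      by (intro Collect_cong conj_cong refl)
    then show ?thesis using prob_links_absent(2)[OF assms(5)[OF t], of "E \<inter> crossing_links S"] by simp
  qed
  \<comment> \<open>The links of \<open>E\<close> across a proper cut form a disconnecting set, to
    which the optimality of \<open>F\<close> applies.\<close>
  have cut_le: "prob {\<omega> \<in> space M. respects_cut (W t \<omega>) S} \<le> q" if "t \<ge> 1" "S \<in> proper_cuts" for t S
  proof -
    have "\<not> connected_graph (E - E \<inter> crossing_links S)"
      using that(2) unfolding disconnected_iff_cut by blast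
    then show ?thesis unfolding absent[OF that(1)] q_def by (intro opt) auto
  qed
  obtain S where S: "S \<in> proper_cuts" "(E - F) \<inter> crossing_links S = {}"
    using F(2) unfolding disconnected_iff_cut by blast
  have cut_ge: "q \<le> prob {\<omega> \<in> space M. respects_cut (W t \<omega>) S}" if "t \<ge> 1" for t
  proof -
    \<comment> \<open>The set \<open>F\<close> may contain further links besides those across
      \<open>S\<close>; their factors are at most 1, so omitting them does not lower the
      product.\<close>
    have sub: "E \<inter> crossing_links S \<subseteq> F" using S(2) by blast
    have "q = (\<Prod>e\<in>F - E \<inter> crossing_links S. 1 - p e) * (\<Prod>e\<in>E \<inter> crossing_links S. 1 - p e)"
      unfolding q_def by (rule prod.subset_diff[OF sub]) simp
    also have "\<dots> \<le> 1 * (\<Prod>e\<in>E \<inter> crossing_links S. 1 - p e)"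
      using F(1) assms(3) by (intro mult_right_mono prod_le_1 prod_nonneg) auto
    finally show ?thesis by (simp add: absent[OF that])
  qed
  have "ereal (p_max M (\<lambda>\<omega>. induced_graph (W t \<omega>)) (realizable_graphs E)) =
      ereal_exp (- mincut E (neg_log_one_minus (link_prob_matrix E p)))" if "t \<ge> 1" for t
    using p_max_eq[OF assms(1) assms(5)[OF that] F opt] q0
    by (simp add: mincut ereal_exp_ln flip: q_def)
  moreover have "has_consensus_rate M W (- ereal_ln q)"
    unfolding has_consensus_rate_def
  proof (intro conjI allI impI)
    show "0 \<le> - ereal_ln q" using q1 by (auto simp: ereal_ln_def)
    fix \<epsilon> :: real assume \<epsilon>: "0 < \<epsilon> \<and> \<epsilon> \<le> 1"
    obtain m C where "\<forall>k>0. prob {\<omega> \<in> space M. \<epsilon> \<le> spectral_norm (backward_product W k \<omega> - averaging_matrix)}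
        \<le> C * real k ^ m * q ^ (k - m)"
      using prob_far_from_consensus_le[OF assms(1) indep W \<delta> cut_le q0 q1] \<epsilon> by blast
    moreover have lower: "q ^ k \<le> prob {\<omega> \<in> space M.
        \<epsilon> \<le> spectral_norm (backward_product W k \<omega> - averaging_matrix)}" for k
      using \<epsilon> by (intro prob_far_from_consensus_ge[OF indep W S(1) cut_ge q0]) auto
    ultimately show "(\<lambda>k. ereal (1 / real k) * ereal_ln (prob
        {\<omega> \<in> space M. \<epsilon> \<le> spectral_norm (backward_product W k \<omega> - averaging_matrix)})) \<longlonglongrightarrow> - (- ereal_ln q)"
      using exponential_rate[OF q0 lower, of C m] by simp
  qed
  ultimately show ?thesis by (simp add: mincut q_def)
qed

end
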